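(* Let $p,q\ge 0$ be integers and let $(Cl_{p,q,1}(\mathbb R),*_1)$ be the $*$-algebra described in the context. For every self-adjoint square matrix $H$ over $(Cl_{p,q,1}(\mathbb R),*_1)$ there are a unitary matrix $U$ over $(Cl_{p,q,1}(\mathbb R),*_1)$ and a diagonal matrix $D$ over $(Cl_{p,q,1}(\mathbb R),*_1)$ such that $UDU^*=H$.
   Context: $Cl_{p,q,1}(\mathbb R)$ is the real associative unital Clifford algebra on $p+q+1$ pairwise anticommuting generators, of which $p$ square to $1$, $q$ square to $-1$ and one, denoted $\delta$, squares to $0$. The involution $*_1$ is the unique $\mathbb R$-linear anti-automorphism with $e^{*_1}=e$ for each generator $e$ with $e^2=1$, $e^{*_1}=-e$ for each generator $e$ with $e^2=-1$, and $\delta^{*_1}=\delta$. For a matrix $M$, $(M^* )_{ij}=(M_{ji})^{*_1}$; $M$ is self-adjoint if $M^*=M$; a square matrix $U$ is unitary if $U^*=U^{-1}$. *)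

theory Defs
  imports "HOL-Analysis.Analysis"
begin

section \<open>A Clifford algebra with generators of every signature\<close>

text \<open>
  Generators \<open>e\<^sub>i\<close> are indexed by all integers and satisfy \<open>e\<^sub>i\<^sup>2 = sgn i\<close>: the positive indices
  square to \<open>1\<close>, the negative ones to \<open>-1\<close>, and \<open>e\<^sub>0\<close> is the nilpotent generator \<open>\<delta>\<close>.
  An element is the function giving its coefficient on each basis blade
  \<open>e\<^sub>A = e\<^bsub>a1\<^esub> \<cdots> e\<^bsub>ak\<^esub>\<close>, where \<open>A = {a1 < \<dots> < ak}\<close> is a finite set of indices. Only finitely many
  generators occur in one element.

  The algebra on \<open>p + q + 1\<close> generators is the subalgebra \<open>Cl p q\<close> spanned by the blades with indices
  in \<open>{-q..p}\<close>; working inside one ambient type makes \<open>p\<close> and \<open>q\<close> ordinary natural numbers.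
  That \<open>Cl p q\<close> is the algebra presented by the \<open>p + q + 1\<close> generators and their relations
  is the content of the universal property proved below.
\<close>

typedef clifford = "{f :: int set \<Rightarrow> real. \<exists>F. finite F \<and> (\<forall>A. f A \<noteq> 0 \<longrightarrow> A \<subseteq> F)}"
  morphisms coord Abs_clifford
  by (rule exI[of _ "\<lambda>_. 0"]) auto

setup_lifting type_definition_clifford

text \<open>
  \<open>e\<^sub>A e\<^sub>B = blade_coeff A B e\<^bsub>A \<triangle> B\<^esub>\<close>: moving the factors of \<open>e\<^sub>B\<close> into place costs one sign
  for every pair \<open>a > b\<close>, and every common index contributes the square of its generator.
\<close>

definition blade_coeff :: "int set \<Rightarrow> int set \<Rightarrow> real" where
  "blade_coeff A B =
     (\<Prod>a\<in>A. \<Prod>b\<in>B. if b < a then -1 else 1) * (\<Prod>i\<in>A \<inter> B. of_int (sgn i))"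

definition clifford_conv :: "(int set \<Rightarrow> real) \<Rightarrow> (int set \<Rightarrow> real) \<Rightarrow> int set \<Rightarrow> real" where
  "clifford_conv f g S =
     (\<Sum>(A, B) | f A \<noteq> 0 \<and> g B \<noteq> 0 \<and> sym_diff A B = S. blade_coeff A B * f A * g B)"

lemma clifford_conv_eq:
  assumes F: "finite F" and f: "\<And>A. f A \<noteq> 0 \<Longrightarrow> A \<subseteq> F" and g: "\<And>A. g A \<noteq> 0 \<Longrightarrow> A \<subseteq> F"
  shows "clifford_conv f g S =
    (\<Sum>A\<in>Pow F. blade_coeff A (sym_diff A S) * f A * g (sym_diff A S))"
proof -
  let ?h = "\<lambda>A. (A, sym_diff A S)"
  let ?P = "{A \<in> Pow F. f A \<noteq> 0 \<and> g (sym_diff A S) \<noteq> 0}"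
  have "{(A, B). f A \<noteq> 0 \<and> g B \<noteq> 0 \<and> sym_diff A B = S} = ?h ` ?P" (is "?L = _")
  proof -
    have "sym_diff A B = S \<longleftrightarrow> B = sym_diff A S" for A B by blast
    then have "?L = {(A, B). f A \<noteq> 0 \<and> g B \<noteq> 0 \<and> B = sym_diff A S}" by simp
    also have "\<dots> = ?h ` ?P" using f by blast
    finally show ?thesis .
  qed
  moreover have "inj_on ?h ?P" by (auto simp: inj_on_def)
  ultimately have "clifford_conv f g S =
    (\<Sum>A\<in>?P. blade_coeff A (sym_diff A S) * f A * g (sym_diff A S))"
    unfolding clifford_conv_def by (simp add: sum.reindex)
  also have "\<dots> = (\<Sum>A\<in>Pow F. blade_coeff A (sym_diff A S) * f A * g (sym_diff A S))"
    using F by (intro sum.mono_neutral_left) auto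
  finally show ?thesis .
qed

lemma clifford_conv_support:
  assumes f: "\<And>A. f A \<noteq> 0 \<Longrightarrow> A \<subseteq> F" and g: "\<And>A. g A \<noteq> 0 \<Longrightarrow> A \<subseteq> F"
    and "clifford_conv f g S \<noteq> 0"
  shows "S \<subseteq> F"
proof -
  have "{(A, B). f A \<noteq> 0 \<and> g B \<noteq> 0 \<and> sym_diff A B = S} \<noteq> {}"
    using assms(3) unfolding clifford_conv_def by (metis (lifting) sum.empty)
  then obtain A B where "f A \<noteq> 0" "g B \<noteq> 0" "sym_diff A B = S" by auto
  then show ?thesis using f[of A] g[of B] by blast
qed

lemma blade_coeff_empty [simp]: "blade_coeff {} A = 1" "blade_coeff A {} = 1"
  by (simp_all add: blade_coeff_def)

lemma prod_pm_sym_diff: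
  fixes s :: "int \<Rightarrow> real"
  assumes "finite A" "finite B" "\<And>i. s i * s i = 1"
  shows "prod s (sym_diff A B) = prod s A * prod s B"
proof -
  have "prod s A = prod s (A - B) * prod s (A \<inter> B)"
    using assms(1) by (metis Int_Diff_Un Int_Diff_disjoint finite_Diff finite_Int mult.commute prod.union_disjoint)
  moreover have "prod s B = prod s (B - A) * prod s (A \<inter> B)"
    using assms(2) by (metis Int_Diff_Un Int_Diff_disjoint finite_Diff finite_Int inf_commute mult.commute prod.union_disjoint)
  moreover have "prod s (A \<inter> B) * prod s (A \<inter> B) = 1"
    using assms(3) by (simp flip: prod.distrib)
  moreover have "prod s (sym_diff A B) = prod s (A - B) * prod s (B - A)"
    using assms by (intro prod.union_disjoint) auto
  ultimately show ?thesis by (simp add: algebra_simps)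
qed

lemma blade_coeff_cocycle:
  assumes "finite A" "finite B" "finite C"
  shows "blade_coeff A B * blade_coeff (sym_diff A B) C =
         blade_coeff A (sym_diff B C) * blade_coeff B C"
proof -
  let ?s = "\<lambda>A B. (\<Prod>a\<in>A. \<Prod>b\<in>B. if b < a then -1 else 1 :: real)"
  let ?q = "\<lambda>i::int. of_int (sgn i) :: real"
  have sq: "(\<Prod>b\<in>B. if b < a then -1 else 1 :: real) * (\<Prod>b\<in>B. if b < a then -1 else 1) = 1"
    for a :: int and B unfolding prod.distrib[symmetric] by (rule prod.neutral) simp
  have l: "?s (sym_diff A B) C = ?s A C * ?s B C"
    by (rule prod_pm_sym_diff[OF assms(1,2)]) (rule sq)
  have r: "?s A (sym_diff B C) = ?s A B * ?s A C"
    unfolding prod.distrib[symmetric]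
    by (intro prod.cong refl prod_pm_sym_diff assms) simp
  have "prod ?q (A \<inter> B) * prod ?q (sym_diff A B \<inter> C) = prod ?q ((A \<inter> B) \<union> (sym_diff A B \<inter> C))"
    using assms by (intro prod.union_disjoint[symmetric]) auto
  also have "(A \<inter> B) \<union> (sym_diff A B \<inter> C) = (A \<inter> sym_diff B C) \<union> (B \<inter> C)" by auto
  also have "prod ?q \<dots> = prod ?q (A \<inter> sym_diff B C) * prod ?q (B \<inter> C)"
    using assms by (intro prod.union_disjoint) auto
  finally have "prod ?q (A \<inter> B) * prod ?q (sym_diff A B \<inter> C) =
    prod ?q (A \<inter> sym_diff B C) * prod ?q (B \<inter> C)" .
  then show ?thesis unfolding blade_coeff_def l r by (simp add: algebra_simps)
qed

lemma support_lift:
  fixes f g :: "int set \<Rightarrow> real"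
  assumes "\<exists>F. finite F \<and> (\<forall>A. f A \<noteq> 0 \<longrightarrow> A \<subseteq> F)" "\<exists>F. finite F \<and> (\<forall>A. g A \<noteq> 0 \<longrightarrow> A \<subseteq> F)"
    and "\<And>F A. (\<And>B. f B \<noteq> 0 \<Longrightarrow> B \<subseteq> F) \<Longrightarrow> (\<And>B. g B \<noteq> 0 \<Longrightarrow> B \<subseteq> F) \<Longrightarrow> h A \<noteq> 0 \<Longrightarrow> A \<subseteq> F"
  shows "\<exists>F. finite F \<and> (\<forall>A. h A \<noteq> (0::real) \<longrightarrow> A \<subseteq> F)"
proof -
  obtain F G where FG: "finite F" "finite G"
    "\<And>A. f A \<noteq> 0 \<Longrightarrow> A \<subseteq> F" "\<And>A. g A \<noteq> 0 \<Longrightarrow> A \<subseteq> G"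
    using assms(1,2) by auto
  have "A \<subseteq> F \<union> G" if "h A \<noteq> 0" for A
    by (rule assms(3)[OF _ _ that]) (use FG in blast)+
  then show ?thesis using FG by (intro exI[of _ "F \<union> G"]) auto
qed

instantiation clifford :: real_algebra_1
begin

lift_definition zero_clifford :: clifford is "\<lambda>_. 0" by auto

lift_definition one_clifford :: clifford is "\<lambda>A. if A = {} then 1 else 0" by auto

lift_definition plus_clifford :: "clifford \<Rightarrow> clifford \<Rightarrow> clifford" is "\<lambda>f g A. f A + g A"
  by (erule support_lift, assumption) (metis add_0)

lift_definition minus_clifford :: "clifford \<Rightarrow> clifford \<Rightarrow> clifford" is "\<lambda>f g A. f A - g A"
  by (erule support_lift, assumption) (metis diff_0_right)

lift_definition uminus_clifford :: "clifford \<Rightarrow> clifford" is "\<lambda>f A. - f A" by auto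

lift_definition scaleR_clifford :: "real \<Rightarrow> clifford \<Rightarrow> clifford" is "\<lambda>r f A. r * f A" by auto

lift_definition times_clifford :: "clifford \<Rightarrow> clifford \<Rightarrow> clifford" is clifford_conv
  by (erule support_lift, assumption) (rule clifford_conv_support)

lemma coord_eqI: "(\<And>A. coord x A = coord y A) \<Longrightarrow> x = y"
  by (simp add: coord_inject[symmetric] fun_eq_iff)

definition clifford_on :: "int set \<Rightarrow> clifford set" where
  "clifford_on I = {x. \<forall>A. coord x A \<noteq> 0 \<longrightarrow> A \<subseteq> I}"

lemma clifford_onD: "x \<in> clifford_on I \<Longrightarrow> coord x A \<noteq> 0 \<Longrightarrow> A \<subseteq> I"
  by (auto simp: clifford_on_def)

lemma clifford_on_zero: "0 \<in> clifford_on I"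
  and clifford_on_one: "1 \<in> clifford_on I"
  and clifford_on_add: "x \<in> clifford_on I \<Longrightarrow> y \<in> clifford_on I \<Longrightarrow> x + y \<in> clifford_on I"
  and clifford_on_scaleR: "x \<in> clifford_on I \<Longrightarrow> r *\<^sub>R x \<in> clifford_on I"
  and clifford_on_uminus: "x \<in> clifford_on I \<Longrightarrow> - x \<in> clifford_on I"
  unfolding clifford_on_def mem_Collect_eq zero_clifford.rep_eq one_clifford.rep_eq
    plus_clifford.rep_eq scaleR_clifford.rep_eq uminus_clifford.rep_eq
  by (simp_all, metis add_0)

lemma clifford_on_mult: "x \<in> clifford_on I \<Longrightarrow> y \<in> clifford_on I \<Longrightarrow> x * y \<in> clifford_on I"
  unfolding clifford_on_def mem_Collect_eq times_clifford.rep_eq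
  by (intro allI impI) (rule clifford_conv_support[of "coord x" _ "coord y"], auto)

lemmas clifford_on_intros =
  clifford_on_zero clifford_on_one clifford_on_add clifford_on_scaleR clifford_on_uminus clifford_on_mult

lemma clifford_on_mono: "x \<in> clifford_on I \<Longrightarrow> I \<subseteq> J \<Longrightarrow> x \<in> clifford_on J"
  by (auto simp: clifford_on_def)

lemma clifford_on_finite: "\<exists>I. finite I \<and> x \<in> clifford_on I"
  using coord[of x] by (simp add: clifford_on_def)

lemma coord_times:
  assumes "finite F" "x \<in> clifford_on F" "y \<in> clifford_on F"
  shows "coord (x * y) S =
    (\<Sum>A\<in>Pow F. blade_coeff A (sym_diff A S) * coord x A * coord y (sym_diff A S))"
  unfolding times_clifford.rep_eq using assms by (intro clifford_conv_eq) (auto dest: clifford_onD)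

instance
proof
  fix x y z :: clifford and a b :: real
  show "x + y + z = x + (y + z)" "x + y = y + x" "0 + x = x" "- x + x = 0" "x - y = x + - y"
    by (transfer; simp add: fun_eq_iff algebra_simps)+
  show "a *\<^sub>R (x + y) = a *\<^sub>R x + a *\<^sub>R y" "(a + b) *\<^sub>R x = a *\<^sub>R x + b *\<^sub>R x"
    "a *\<^sub>R b *\<^sub>R x = (a * b) *\<^sub>R x" "1 *\<^sub>R x = x"
    by (transfer; simp add: fun_eq_iff algebra_simps)+
  show "(0::clifford) \<noteq> 1"
    by transfer (metis zero_neq_one)
  obtain I J K where "finite I" "x \<in> clifford_on I" "finite J" "y \<in> clifford_on J"
    "finite K" "z \<in> clifford_on K"
    using clifford_on_finite by meson
  then obtain F where F: "finite F" and xyz: "x \<in> clifford_on F" "y \<in> clifford_on F" "z \<in> clifford_on F"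
    using that[of "I \<union> J \<union> K"] by (simp add: clifford_on_mono le_supI1)
  note ct = coord_times[OF F]
  show "(x + y) * z = x * z + y * z"
    by (rule coord_eqI)
      (simp add: plus_clifford.rep_eq ct xyz clifford_on_intros algebra_simps sum.distrib)
  show "x * (y + z) = x * y + x * z"
    by (rule coord_eqI)
      (simp add: plus_clifford.rep_eq ct xyz clifford_on_intros algebra_simps sum.distrib)
  show "a *\<^sub>R x * y = a *\<^sub>R (x * y)"
    by (rule coord_eqI)
      (simp add: scaleR_clifford.rep_eq ct xyz clifford_on_intros algebra_simps sum_distrib_left)
  show "x * a *\<^sub>R y = a *\<^sub>R (x * y)"
    by (rule coord_eqI)
      (simp add: scaleR_clifford.rep_eq ct xyz clifford_on_intros algebra_simps sum_distrib_left)
  have P: "finite (Pow F)" "{} \<in> Pow F" using F by auto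
  show "1 * x = x"
  proof (rule coord_eqI)
    fix S
    have "coord (1 * x) S = (\<Sum>A\<in>Pow F. if A = {} then coord x S else 0)"
      unfolding ct[OF clifford_on_one xyz(1)] by (intro sum.cong refl) (simp add: one_clifford.rep_eq)
    also have "\<dots> = coord x S" using P by simp
    finally show "coord (1 * x) S = coord x S" .
  qed
  show "x * 1 = x"
  proof (rule coord_eqI)
    fix S
    have "coord (x * 1) S = (\<Sum>A\<in>Pow F. if A = S then coord x S else 0)"
      unfolding ct[OF xyz(1) clifford_on_one]
      by (intro sum.cong refl) (auto simp: one_clifford.rep_eq)
    also have "\<dots> = coord x S" using P clifford_onD[OF xyz(1), of S] by (auto simp: sum.delta)
    finally show "coord (x * 1) S = coord x S" .
  qed
  show "x * y * z = x * (y * z)"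
  proof (rule coord_eqI)
    fix S
    let ?c = "blade_coeff"
    let ?t = "\<lambda>A T. ?c A (sym_diff A T) * ?c T (sym_diff T S) *
      coord x A * coord y (sym_diff A T) * coord z (sym_diff T S)"
    have "coord (x * y * z) S = (\<Sum>T\<in>Pow F. \<Sum>A\<in>Pow F. ?t A T)"
      by (simp only: ct[OF clifford_on_mult[OF xyz(1,2)] xyz(3)] ct[OF xyz(1,2)]
        sum_distrib_left sum_distrib_right mult_ac)
    also have "\<dots> = (\<Sum>A\<in>Pow F. \<Sum>T\<in>Pow F. ?t A T)"
      by (rule sum.swap)
    also have "\<dots> = (\<Sum>A\<in>Pow F. \<Sum>B\<in>Pow F. ?t A (sym_diff A B))"
    proof (rule sum.cong[OF refl])
      fix A assume A: "A \<in> Pow F"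
      have "sym_diff A (sym_diff A B) = B" for B by auto
      then show "(\<Sum>T\<in>Pow F. ?t A T) = (\<Sum>B\<in>Pow F. ?t A (sym_diff A B))"
        using A by (intro sum.reindex_bij_witness[of _ "sym_diff A" "sym_diff A"]) auto
    qed
    also have "\<dots> = (\<Sum>A\<in>Pow F. \<Sum>B\<in>Pow F. ?c A (sym_diff A S) *
      (?c B (sym_diff B (sym_diff A S)) * coord x A * coord y B * coord z (sym_diff B (sym_diff A S))))"
    proof (intro sum.cong refl)
      fix A B assume AB: "A \<in> Pow F" "B \<in> Pow F"
      have e1: "sym_diff A (sym_diff A B) = B" by auto
      have e2: "sym_diff (sym_diff A B) S = sym_diff B (sym_diff A S)" by auto
      have e3: "sym_diff B (sym_diff B (sym_diff A S)) = sym_diff A S" by auto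
      show "?t A (sym_diff A B) = ?c A (sym_diff A S) *
        (?c B (sym_diff B (sym_diff A S)) * coord x A * coord y B * coord z (sym_diff B (sym_diff A S)))"
      proof (cases "coord z (sym_diff B (sym_diff A S)) = 0")
        case True
        then show ?thesis unfolding e1 e2 by simp
      next
        case False
        then have "finite (sym_diff B (sym_diff A S))" using clifford_onD[OF xyz(3)] F finite_subset by metis
        moreover have "finite A" "finite B" using AB F finite_subset by auto
        ultimately have "?c A B * ?c (sym_diff A B) (sym_diff B (sym_diff A S)) =
          ?c A (sym_diff A S) * ?c B (sym_diff B (sym_diff A S))"
          using blade_coeff_cocycle[of A B "sym_diff B (sym_diff A S)"] unfolding e3 by simp
        then show ?thesis unfolding e1 e2 by (simp add: mult_ac)
      qed
    qed
    also have "\<dots> = coord (x * (y * z)) S"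
      by (simp only: ct[OF xyz(1) clifford_on_mult[OF xyz(2,3)]] ct[OF xyz(2,3)]
        sum_distrib_left sum_distrib_right mult_ac)
    finally show "coord (x * y * z) S = coord (x * (y * z)) S" .
  qed
qed

end


section \<open>Basis, generators and universal property\<close>

lift_definition blade :: "int set \<Rightarrow> clifford" is "\<lambda>A B. if finite A \<and> B = A then 1 else 0"
  by auto

definition gen :: "int \<Rightarrow> clifford" where
  "gen i = blade {i}"

definition Cl :: "nat \<Rightarrow> nat \<Rightarrow> clifford set" where
  "Cl p q = clifford_on {- int q..int p}"

lemma blade_in: "A \<subseteq> I \<Longrightarrow> blade A \<in> clifford_on I"
  by (auto simp: clifford_on_def blade.rep_eq split: if_splits)

lemma gen_in: "i \<in> I \<Longrightarrow> gen i \<in> clifford_on I"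
  by (simp add: gen_def blade_in)

lemma blade_empty: "blade {} = 1"
  by (rule coord_eqI) (simp add: blade.rep_eq one_clifford.rep_eq)

lemma blade_mult:
  assumes "finite A" "finite B"
  shows "blade A * blade B = blade_coeff A B *\<^sub>R blade (sym_diff A B)"
proof (rule coord_eqI)
  fix S
  have "coord (blade A * blade B) S =
    (\<Sum>C\<in>Pow (A \<union> B). blade_coeff C (sym_diff C S) * coord (blade A) C * coord (blade B) (sym_diff C S))"
    using assms by (intro coord_times blade_in) auto
  also have "\<dots> = (\<Sum>C\<in>Pow (A \<union> B). if C = A then
      (if sym_diff A S = B then blade_coeff A B else 0) else 0)"
    using assms by (intro sum.cong refl) (auto simp: blade.rep_eq)
  also have "\<dots> = (if sym_diff A S = B then blade_coeff A B else 0)"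
    using assms by (subst sum.delta) auto
  also have "sym_diff A S = B \<longleftrightarrow> S = sym_diff A B" by blast
  finally show "coord (blade A * blade B) S = coord (blade_coeff A B *\<^sub>R blade (sym_diff A B)) S"
    using assms by (simp add: blade.rep_eq scaleR_clifford.rep_eq)
qed

lemma gen_square: "gen i * gen i = of_int (sgn i)"
  by (simp add: gen_def blade_mult blade_coeff_def blade_empty sgn_if)

lemma gen_anticommute: "i \<noteq> j \<Longrightarrow> gen i * gen j = - (gen j * gen i)"
  by (cases "i < j") (auto simp: gen_def blade_mult blade_coeff_def insert_commute)

lemma coord_sum: "coord (sum f X) A = (\<Sum>x\<in>X. coord (f x) A)"
  by (induction X rule: infinite_finite_induct)
    (auto simp: zero_clifford.rep_eq plus_clifford.rep_eq)

lemma blade_expansion: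
  assumes "finite I" "x \<in> clifford_on I"
  shows "x = (\<Sum>A\<in>Pow I. coord x A *\<^sub>R blade A)"
proof (rule coord_eqI)
  fix B
  have "coord (\<Sum>A\<in>Pow I. coord x A *\<^sub>R blade A) B = (\<Sum>A\<in>Pow I. if A = B then coord x B else 0)"
    unfolding coord_sum using assms(1) finite_subset
    by (intro sum.cong refl) (auto simp: scaleR_clifford.rep_eq blade.rep_eq)
  then show "coord x B = coord (\<Sum>A\<in>Pow I. coord x A *\<^sub>R blade A) B"
    using assms clifford_onD[OF assms(2), of B] by (auto simp: sum.delta)
qed

lemma blade_coeff_min:
  assumes "\<And>a. a \<in> A \<Longrightarrow> i < a"
  shows "blade_coeff {i} A = 1"
proof -
  have "(\<Prod>b\<in>A. if b < i then -1 else 1 :: real) = 1"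
    by (rule prod.neutral) (use assms in force)
  moreover have "{i} \<inter> A = {}" using assms by force
  ultimately show ?thesis by (simp add: blade_coeff_def)
qed

lemma sym_diff_min:
  assumes "\<And>a. a \<in> A \<Longrightarrow> i < (a::int)"
  shows "sym_diff {i} A = insert i A"
  using assms by force

lemma blade_insert_min:
  assumes "finite A" "\<And>a. a \<in> A \<Longrightarrow> i < a"
  shows "blade (insert i A) = gen i * blade A"
  using blade_mult[of "{i}" A] assms blade_coeff_min[OF assms(2)] sym_diff_min[OF assms(2)]
  by (simp add: gen_def)

lemma clifford_on_induct [consumes 2, case_names one gen add scaleR]:
  assumes "finite I" "x \<in> clifford_on I"
    and one: "P 1"
    and gen: "\<And>i x. i \<in> I \<Longrightarrow> x \<in> clifford_on I \<Longrightarrow> P x \<Longrightarrow> P (gen i * x)"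
    and add: "\<And>x y. x \<in> clifford_on I \<Longrightarrow> y \<in> clifford_on I \<Longrightarrow> P x \<Longrightarrow> P y \<Longrightarrow> P (x + y)"
    and scaleR: "\<And>r x. x \<in> clifford_on I \<Longrightarrow> P x \<Longrightarrow> P (r *\<^sub>R x)"
  shows "P x"
proof -
  have blade: "P (blade A)" if "A \<subseteq> I" for A
    using finite_subset[OF that \<open>finite I\<close>] that
  proof (induction A rule: finite_linorder_min_induct)
    case empty
    then show ?case by (simp add: blade_empty one)
  next
    case (insert i A)
    then show ?case by (simp add: blade_insert_min gen blade_in)
  qed
  have "(\<Sum>A\<in>X. c A *\<^sub>R blade A) \<in> clifford_on I \<and> P (\<Sum>A\<in>X. c A *\<^sub>R blade A)"
    if "finite X" "X \<subseteq> Pow I" for X c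
    using that
  proof (induction X)
    case empty
    then show ?case using scaleR[OF clifford_on_one one, of 0] by (simp add: clifford_on_zero)
  next
    case (insert A X)
    then show ?case by (simp add: blade blade_in add scaleR clifford_on_intros)
  qed
  then show ?thesis
    using blade_expansion[OF assms(1,2)] assms(1) by (metis finite_Pow_iff order_refl)
qed

context
  fixes v :: "int \<Rightarrow> 'b::real_algebra_1" and I :: "int set"
  assumes sq: "\<And>i. i \<in> I \<Longrightarrow> v i * v i = of_int (sgn i)"
    and ac: "\<And>i j. i \<in> I \<Longrightarrow> j \<in> I \<Longrightarrow> i \<noteq> j \<Longrightarrow> v i * v j = - (v j * v i)"
begin

private definition V :: "int set \<Rightarrow> 'b" where
  "V A = prod_list (map v (sorted_list_of_set A))"

private lemma V_empty: "V {} = 1"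
  by (simp add: V_def)

private lemma V_insert_min:
  assumes "finite A" "\<And>a. a \<in> A \<Longrightarrow> i < a"
  shows "V (insert i A) = v i * V A"
proof -
  have "i \<notin> A" using assms(2) by blast
  then have "sorted_list_of_set (insert i A) = i # sorted_list_of_set A"
    using assms by (subst sorted_list_of_set_insert) (auto intro!: insort_is_Cons simp: less_imp_le)
  then show ?thesis by (simp add: V_def)
qed

private lemma v_mult_V:
  assumes "finite B" "B \<subseteq> I" "i \<in> I"
  shows "v i * V B = blade_coeff {i} B *\<^sub>R V (sym_diff {i} B)"
  using assms
proof (induction B rule: finite_linorder_min_induct)
  case empty
  then show ?case using V_insert_min[of "{}" i] by (simp add: V_empty)
next
  case (insert b B)
  have bB: "\<And>a. a \<in> B \<Longrightarrow> b < a" and fin: "finite B" and b: "b \<in> I" and nb: "b \<notin> B"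
    using insert by auto
  consider "i < b" | "i = b" | "b < i" by linarith
  then show ?case
  proof cases
    case 1
    then have "\<And>a. a \<in> insert b B \<Longrightarrow> i < a" using bB by force
    then show ?thesis
      using fin by (simp only: blade_coeff_min sym_diff_min V_insert_min finite_insert scaleR_one)
  next
    case 2
    have "(\<Prod>c\<in>B. if c < i then -1 else 1 :: real) = 1"
      by (rule prod.neutral) (use bB 2 in force)
    then have "blade_coeff {i} (insert b B) = of_int (sgn i)"
      using 2 fin nb by (simp add: blade_coeff_def)
    moreover have "sym_diff {i} (insert b B) = B" using 2 nb by auto
    moreover have "v i * V (insert b B) = of_int (sgn i) * V B"
      using 2 V_insert_min[OF fin bB] sq[OF b] by (simp flip: mult.assoc)
    ultimately show ?thesis by (simp add: scaleR_conv_of_real)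
  next
    case 3
    have "v i * V (insert b B) = v i * v b * V B"
      using V_insert_min[OF fin bB] by (simp add: mult.assoc)
    also have "\<dots> = - (v b * (v i * V B))"
      using ac[of i b] 3 b insert.prems by (simp add: mult.assoc)
    also have "\<dots> = - (blade_coeff {i} B *\<^sub>R (v b * V (sym_diff {i} B)))"
      using insert by simp
    also have "v b * V (sym_diff {i} B) = V (insert b (sym_diff {i} B))"
      using fin bB 3 by (intro V_insert_min[symmetric]) auto
    also have "insert b (sym_diff {i} B) = sym_diff {i} (insert b B)"
      using 3 nb by auto
    also have "- (blade_coeff {i} B *\<^sub>R V (sym_diff {i} (insert b B))) =
      blade_coeff {i} (insert b B) *\<^sub>R V (sym_diff {i} (insert b B))"
    proof -
      have "{i} \<inter> insert b B = {i} \<inter> B" using 3 by auto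
      then show ?thesis using 3 fin nb by (simp add: blade_coeff_def)
    qed
    finally show ?thesis .
  qed
qed

private lemma V_mult:
  assumes "finite A" "finite B" "A \<subseteq> I" "B \<subseteq> I"
  shows "V A * V B = blade_coeff A B *\<^sub>R V (sym_diff A B)"
  using assms
proof (induction A rule: finite_linorder_min_induct)
  case empty
  then show ?case by (simp add: V_empty)
next
  case (insert a A)
  then have min: "\<And>x. x \<in> A \<Longrightarrow> a < x" by auto
  have "V (insert a A) * V B = v a * (V A * V B)"
    using V_insert_min[of A a] insert min by (simp add: mult.assoc)
  also have "\<dots> = blade_coeff A B *\<^sub>R (v a * V (sym_diff A B))"
    using insert by simp
  also have "v a * V (sym_diff A B) = blade_coeff {a} (sym_diff A B) *\<^sub>R V (sym_diff {a} (sym_diff A B))"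
    using insert by (intro v_mult_V) auto
  also have "blade_coeff A B *\<^sub>R \<dots> =
      (blade_coeff {a} (sym_diff A B) * blade_coeff A B) *\<^sub>R V (sym_diff {a} (sym_diff A B))"
    by (simp add: mult.commute)
  also have "blade_coeff {a} (sym_diff A B) * blade_coeff A B = blade_coeff (insert a A) B"
    using blade_coeff_cocycle[of "{a}" A B] insert(1) \<open>finite B\<close>
      blade_coeff_min[OF min] sym_diff_min[OF min] by simp
  also have "sym_diff {a} (sym_diff A B) = sym_diff (insert a A) B"
    using min by blast
  finally show ?case .
qed

theorem clifford_universal_property:
  assumes I: "finite I"
  shows "\<exists>\<phi>. linear \<phi> \<and> \<phi> 1 = 1 \<and> (\<forall>i\<in>I. \<phi> (gen i) = v i) \<and>
    (\<forall>x\<in>clifford_on I. \<forall>y\<in>clifford_on I. \<phi> (x * y) = \<phi> x * \<phi> y)"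
proof -
  define \<phi> where "\<phi> x = (\<Sum>A\<in>Pow I. coord x A *\<^sub>R V A)" for x
  have phi_blade: "\<phi> (blade A) = V A" if "A \<subseteq> I" for A
  proof -
    have "\<phi> (blade A) = (\<Sum>B\<in>Pow I. if B = A then V A else 0)"
      unfolding \<phi>_def using finite_subset[OF that I]
      by (intro sum.cong refl) (auto simp: blade.rep_eq)
    then show ?thesis using that I by (simp add: sum.delta)
  qed
  have lin: "linear \<phi>"
    by (rule linearI) (auto simp: \<phi>_def plus_clifford.rep_eq scaleR_clifford.rep_eq
        sum.distrib scaleR_left_distrib scaleR_sum_right)
  have blades: "\<phi> (blade A * blade B) = V A * V B" if "A \<in> Pow I" "B \<in> Pow I" for A B
  proof -
    have "finite A" "finite B" "sym_diff A B \<subseteq> I" using that I finite_subset by auto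
    then show ?thesis
      using that by (simp add: blade_mult V_mult linear_cmul[OF lin] phi_blade)
  qed
  have "\<phi> (x * y) = \<phi> x * \<phi> y" if x: "x \<in> clifford_on I" and y: "y \<in> clifford_on I" for x y
  proof -
    have "\<phi> (x * y) = \<phi> ((\<Sum>A\<in>Pow I. coord x A *\<^sub>R blade A) * (\<Sum>B\<in>Pow I. coord y B *\<^sub>R blade B))"
      using blade_expansion[OF I x] blade_expansion[OF I y] by simp
    also have "\<dots> = (\<Sum>A\<in>Pow I. \<Sum>B\<in>Pow I. coord x A *\<^sub>R coord y B *\<^sub>R \<phi> (blade A * blade B))"
      by (simp add: sum_product linear_sum[OF lin] linear_cmul[OF lin] mult.commute)
    also have "\<dots> = (\<Sum>A\<in>Pow I. \<Sum>B\<in>Pow I. coord x A *\<^sub>R coord y B *\<^sub>R (V A * V B))"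
      using blades by (intro sum.cong refl) simp
    also have "\<dots> = \<phi> x * \<phi> y"
      by (simp add: \<phi>_def sum_product mult.commute)
    finally show ?thesis .
  qed
  moreover have "\<phi> 1 = 1"
    using phi_blade[of "{}"] by (simp add: V_empty blade_empty)
  moreover have "\<phi> (gen i) = v i" if "i \<in> I" for i
    using phi_blade[of "{i}"] V_insert_min[of "{}" i] that by (simp add: gen_def V_empty)
  ultimately show ?thesis using lin by blast
qed

end

section \<open>The involution\<close>

text \<open>
  On a blade, \<open>(e\<^bsub>a1\<^esub> \<cdots> e\<^bsub>ak\<^esub>)\<^sup>* = e\<^bsub>ak\<^esub>\<^sup>* \<cdots> e\<^bsub>a1\<^esub>\<^sup>*\<close>; reversing \<open>k\<close> anticommuting factors costs
  \<open>k choose 2\<close> signs, and each generator of square \<open>-1\<close> contributes one more.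
\<close>

definition star_sign :: "int set \<Rightarrow> real" where
  "star_sign A = (-1) ^ (card A choose 2) * (\<Prod>i\<in>A. if i < 0 then -1 else 1)"

lift_definition clifford_star :: "clifford \<Rightarrow> clifford" is "\<lambda>f A. star_sign A * f A"
  by auto

lemma star_add: "clifford_star (x + y) = clifford_star x + clifford_star y"
  and star_scaleR: "clifford_star (r *\<^sub>R x) = r *\<^sub>R clifford_star x"
  by (transfer; simp add: fun_eq_iff algebra_simps)+

lemma star_one: "clifford_star 1 = 1"
  by transfer (simp add: fun_eq_iff star_sign_def numeral_2_eq_2)

lemma star_gen: "clifford_star (gen i) = (if i < 0 then - gen i else gen i)"
  by (rule coord_eqI)
    (auto simp: gen_def clifford_star.rep_eq blade.rep_eq uminus_clifford.rep_eq star_sign_def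
      numeral_2_eq_2)

lemma star_in: "x \<in> clifford_on I \<Longrightarrow> clifford_star x \<in> clifford_on I"
  by (auto simp: clifford_on_def clifford_star.rep_eq)

lemma star_star: "clifford_star (clifford_star x) = x"
proof (rule coord_eqI)
  fix A
  have "star_sign A * star_sign A = (\<Prod>i\<in>A. (if i < 0 then -1 else 1) * (if i < 0 then -1 else 1))"
    by (simp add: star_sign_def prod.distrib flip: power_mult_distrib)
  also have "\<dots> = 1" by (rule prod.neutral) simp
  finally show "coord (clifford_star (clifford_star x)) A = coord x A"
    by (simp add: clifford_star.rep_eq flip: mult.assoc)
qed

lemma blade_coeff_swap:
  assumes "finite A" "finite B"
  shows "blade_coeff A B = (-1) ^ (card A * card B + card (A \<inter> B)) * blade_coeff B A"
proof -
  let ?s = "\<lambda>A B. (\<Prod>a\<in>A. \<Prod>b\<in>B. if b < a then -1 else 1 :: real)"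
  have sw: "?s B A = (\<Prod>a\<in>A. \<Prod>b\<in>B. if a < b then -1 else 1)" by (rule prod.swap)
  have "?s B A * ?s B A = (\<Prod>b\<in>B. \<Prod>a\<in>A. (if a < b then -1 else 1) * (if a < b then -1 else 1))"
    by (simp only: prod.distrib)
  also have "\<dots> = 1" by (intro prod.neutral ballI) auto
  finally have sq: "?s B A * ?s B A = 1" .
  have inner: "(\<Prod>b\<in>B. if a \<noteq> b then -1 else 1 :: real) = (-1) ^ card B * (if a \<in> B then -1 else 1)" for a
  proof (cases "a \<in> B")
    case True
    have "(\<Prod>b\<in>B. if a \<noteq> b then -1 else 1 :: real) =
      (\<Prod>b\<in>B - {a}. if a \<noteq> b then -1 else 1)"
      using True by (simp add: prod.remove[OF assms(2)])
    also have "\<dots> = (\<Prod>b\<in>B - {a}. -1)"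
      by (intro prod.cong refl) auto
    also have "\<dots> = (-1) ^ card (B - {a})"
      by (rule prod_constant)
    also have "\<dots> = (-1) ^ Suc (card (B - {a})) * (-1)" by simp
    also have "Suc (card (B - {a})) = card B"
      using True assms(2) by (rule card.remove[symmetric, rotated])
    finally show ?thesis using True by simp
  next
    case False
    then have "(\<Prod>b\<in>B. if a \<noteq> b then -1 else 1 :: real) = (\<Prod>b\<in>B. -1)"
      by (intro prod.cong refl) auto
    then show ?thesis using False by simp
  qed
  have "?s A B * ?s B A = (\<Prod>a\<in>A. \<Prod>b\<in>B. if a \<noteq> b then -1 else 1)"
    unfolding sw prod.distrib[symmetric]
    by (intro prod.cong refl) simp
  also have "\<dots> = (-1) ^ (card A * card B) * (\<Prod>a\<in>A. if a \<in> B then -1 else 1)"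
    unfolding inner prod.distrib by (simp add: mult.commute[of "card A"] power_mult)
  also have "(\<Prod>a\<in>A. if a \<in> B then -1 else 1 :: real) = (\<Prod>a\<in>A \<inter> B. -1)"
    by (rule prod.inter_restrict[OF assms(1), symmetric])
  finally have "?s A B * ?s B A = (-1) ^ (card A * card B + card (A \<inter> B))"
    by (simp add: power_add)
  then have "?s A B = (-1) ^ (card A * card B + card (A \<inter> B)) * ?s B A"
    using sq by (metis (no_types) mult.assoc mult.right_neutral)
  then show ?thesis by (simp add: blade_coeff_def Int_commute)
qed

lemma star_sign_sym_diff:
  assumes "finite A" "finite B"
  shows "star_sign (sym_diff A B) =
    (-1) ^ (card A * card B + card (A \<inter> B)) * (star_sign A * star_sign B)"
proof -
  define a b c where "a = card (A - B)" and "b = card (B - A)" and "c = card (A \<inter> B)"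
  have A: "card A = a + c"
    unfolding a_def c_def using assms by (metis Int_Diff_Un Int_Diff_disjoint add.commute card_Un_disjoint finite_Diff finite_Int)
  have B: "card B = b + c"
    unfolding b_def c_def using assms by (metis Int_Diff_Un Int_Diff_disjoint add.commute card_Un_disjoint finite_Diff finite_Int inf_commute)
  have S: "card (sym_diff A B) = a + b"
    unfolding a_def b_def using assms by (intro card_Un_disjoint) auto
  have ch: "(m + n) choose 2 = (m choose 2) + (n choose 2) + m * n" for m n :: nat
    by (induction n) (auto simp: numeral_2_eq_2)
  have "even (((a + b) choose 2) + ((card A * card B + c) + ((card A choose 2) + (card B choose 2))))"
    unfolding A B
    by (cases "even a"; cases "even b"; cases "even c") (simp_all add: ch algebra_simps)
  then have "(-1 :: real) ^ ((a + b) choose 2) =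
    (-1) ^ ((card A * card B + c) + ((card A choose 2) + (card B choose 2)))"
    by (metis (no_types, lifting) even_add neg_one_even_power neg_one_odd_power)
  moreover have "(\<Prod>i\<in>sym_diff A B. if i < 0 then -1 else 1 :: real) =
    (\<Prod>i\<in>A. if i < 0 then -1 else 1) * (\<Prod>i\<in>B. if i < 0 then -1 else 1)"
    by (rule prod_pm_sym_diff[OF assms]) auto
  ultimately show ?thesis
    unfolding star_sign_def S by (simp add: power_add c_def)
qed

lemma star_mult: "clifford_star (x * y) = clifford_star y * clifford_star x"
proof -
  obtain J K where "finite J" "x \<in> clifford_on J" "finite K" "y \<in> clifford_on K"
    using clifford_on_finite by meson
  then obtain I where I: "finite I" and x: "x \<in> clifford_on I" and y: "y \<in> clifford_on I"
    using that[of "J \<union> K"] by (simp add: clifford_on_mono)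
  have star_sum: "clifford_star (sum f X) = (\<Sum>a\<in>X. clifford_star (f a))" for f and X :: "'a set"
  proof -
    have "linear clifford_star" by (rule linearI) (simp_all add: star_add star_scaleR)
    then show ?thesis by (rule linear_sum)
  qed
  have star_blade: "clifford_star (blade A) = star_sign A *\<^sub>R blade A" for A
    by (rule coord_eqI) (simp add: clifford_star.rep_eq blade.rep_eq scaleR_clifford.rep_eq)
  have blades: "clifford_star (blade A * blade B) = clifford_star (blade B) * clifford_star (blade A)"
    if "A \<in> Pow I" "B \<in> Pow I" for A B
  proof -
    have fin: "finite A" "finite B" using that I finite_subset by auto
    let ?e = "(-1 :: real) ^ (card A * card B + card (A \<inter> B))"
    have e: "?e * ?e = 1" by (simp flip: power_mult_distrib)
    have "clifford_star (blade A * blade B) =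
      (blade_coeff A B * star_sign (sym_diff A B)) *\<^sub>R blade (sym_diff A B)"
      by (simp add: blade_mult fin star_scaleR star_blade)
    also have "blade_coeff A B * star_sign (sym_diff A B) =
      (?e * ?e) * (star_sign A * star_sign B * blade_coeff B A)"
      unfolding blade_coeff_swap[OF fin] star_sign_sym_diff[OF fin] by (simp only: mult_ac)
    also have "sym_diff A B = sym_diff B A" by auto
    finally show ?thesis
      unfolding e by (simp add: star_blade blade_mult fin mult_ac)
  qed
  have "clifford_star (x * y) = clifford_star
      ((\<Sum>A\<in>Pow I. coord x A *\<^sub>R blade A) * (\<Sum>B\<in>Pow I. coord y B *\<^sub>R blade B))"
    using blade_expansion[OF I x] blade_expansion[OF I y] by simp
  also have "\<dots> = (\<Sum>A\<in>Pow I. \<Sum>B\<in>Pow I. coord x A *\<^sub>R coord y B *\<^sub>R clifford_star (blade A * blade B))"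
    by (simp add: sum_product star_sum star_scaleR mult.commute)
  also have "\<dots> = (\<Sum>A\<in>Pow I. \<Sum>B\<in>Pow I. coord x A *\<^sub>R coord y B *\<^sub>R
      (clifford_star (blade B) * clifford_star (blade A)))"
    using blades by (intro sum.cong refl) simp
  also have "\<dots> = (\<Sum>B\<in>Pow I. \<Sum>A\<in>Pow I. coord x A *\<^sub>R coord y B *\<^sub>R
      (clifford_star (blade B) * clifford_star (blade A)))"
    by (rule sum.swap)
  also have "\<dots> = clifford_star (\<Sum>B\<in>Pow I. coord y B *\<^sub>R blade B) *
      clifford_star (\<Sum>A\<in>Pow I. coord x A *\<^sub>R blade A)"
    by (simp add: sum_product star_sum star_scaleR mult.commute)
  also have "\<dots> = clifford_star y * clifford_star x"
    using blade_expansion[OF I x] blade_expansion[OF I y] by simp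
  finally show ?thesis .
qed

lemma star_unique:
  assumes "x \<in> Cl p q"
    and "\<And>x y. x \<in> Cl p q \<Longrightarrow> y \<in> Cl p q \<Longrightarrow> s (x + y) = s x + s y"
    and "\<And>r x. x \<in> Cl p q \<Longrightarrow> s (r *\<^sub>R x) = r *\<^sub>R s x"
    and "\<And>x y. x \<in> Cl p q \<Longrightarrow> y \<in> Cl p q \<Longrightarrow> s (x * y) = s y * s x"
    and "s 1 = 1"
    and "\<And>i. i \<in> {- int q..int p} \<Longrightarrow> s (gen i) = (if i < 0 then - gen i else gen i)"
  shows "s x = clifford_star x"
proof -
  have "finite {- int q..int p}" "x \<in> clifford_on {- int q..int p}"
    using assms(1) by (simp_all add: Cl_def)
  then show ?thesis
  proof (induction rule: clifford_on_induct)
    case one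
    then show ?case by (simp add: assms star_one)
  next
    case (gen i x)
    then have "gen i \<in> Cl p q" "x \<in> Cl p q" by (simp_all add: Cl_def gen_in)
    then show ?case using gen assms(4,6) by (simp add: star_mult star_gen)
  next
    case (add x y)
    then show ?case by (simp add: assms(2) star_add Cl_def)
  next
    case (scaleR r x)
    then show ?case by (simp add: assms(3) star_scaleR Cl_def)
  qed
qed

section \<open>Matrices\<close>

definition matrix_over :: "'a set \<Rightarrow> 'a^'n^'n \<Rightarrow> bool" where
  "matrix_over R M \<longleftrightarrow> (\<forall>i j. M $ i $ j \<in> R)"

definition adjoint_matrix :: "clifford^'n^'n \<Rightarrow> clifford^'n^'n" where
  "adjoint_matrix M = (\<chi> i j. clifford_star (M $ j $ i))"

definition self_adjoint :: "clifford^'n^'n \<Rightarrow> bool" where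
  "self_adjoint M \<longleftrightarrow> adjoint_matrix M = M"

definition unitary_matrix :: "clifford^'n^'n \<Rightarrow> bool" where
  "unitary_matrix U \<longleftrightarrow> U ** adjoint_matrix U = mat 1 \<and> adjoint_matrix U ** U = mat 1"

definition diagonal_matrix :: "'a::zero^'n^'n \<Rightarrow> bool" where
  "diagonal_matrix D \<longleftrightarrow> (\<forall>i j. i \<noteq> j \<longrightarrow> D $ i $ j = 0)"

end

theory Submission
  imports Defs
begin

text \<open>
  Write \<open>H = H\<^sub>0 + E \<delta>\<close> with \<open>H\<^sub>0, E\<close> over the nondegenerate subalgebra, and let \<open>\<sigma>\<close> be its grade
  involution, so that \<open>\<delta> x = \<sigma>(x) \<delta>\<close>. Self-adjointness means \<open>H\<^sub>0\<^sup>* = H\<^sub>0\<close> and \<open>\<sigma>(E)\<^sup>* = E\<close>.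
  Conjugation by a unitary \<open>1 + X \<delta>\<close> adds \<open>L X = X \<sigma>(H\<^sub>0) - H\<^sub>0 X\<close> to \<open>E\<close>; since \<open>L\<close> is self-adjoint
  for the positive definite form \<open>tr (A\<^sup>* B)\<close>, one can reach \<open>L E = 0\<close>. It then suffices to find one
  unitary \<open>U\<close> over the nondegenerate subalgebra such that \<open>U\<^sup>* H\<^sub>0 U\<close> and \<open>U\<^sup>* E \<sigma>(U)\<close> are diagonal.
  First maximize \<open>tr (\<Lambda> U\<^sup>* E \<sigma>(U))\<close>, for a real diagonal \<open>\<Lambda>\<close> with distinct positive entries, over the
  compact group of all unitary matrices: the vanishing derivative at a maximum forces \<open>E\<close> to become
  diagonal. Then maximize \<open>tr (\<Lambda> U\<^sup>* H\<^sub>0 U)\<close> over the subgroup that fixes the new \<open>E\<close>; because of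
  \<open>L E = 0\<close> the gradient is tangent to this subgroup, and \<open>H\<^sub>0\<close> becomes diagonal too.
\<close>

section \<open>The grade involution and the nilpotent generator\<close>

lift_definition grade :: "clifford \<Rightarrow> clifford" is "\<lambda>f A. (-1) ^ card A * f A"
  by auto

lemma grade_add: "grade (x + y) = grade x + grade y"
  and grade_diff: "grade (x - y) = grade x - grade y"
  and grade_uminus: "grade (- x) = - grade x"
  and grade_scaleR: "grade (r *\<^sub>R x) = r *\<^sub>R grade x"
  by (transfer; simp add: fun_eq_iff algebra_simps)+

lemma grade_one: "grade 1 = 1"
  by transfer (simp add: fun_eq_iff)

lemma grade_gen: "grade (gen i) = - gen i"
  by (rule coord_eqI) (simp add: gen_def grade.rep_eq blade.rep_eq uminus_clifford.rep_eq)

lemma grade_in: "x \<in> clifford_on I \<Longrightarrow> grade x \<in> clifford_on I"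
  by (auto simp: clifford_on_def grade.rep_eq)

lemma grade_grade: "grade (grade x) = x"
  by transfer (simp add: fun_eq_iff flip: mult.assoc power_mult_distrib)

lemma grade_star: "grade (clifford_star x) = clifford_star (grade x)"
  by transfer (simp add: fun_eq_iff mult.left_commute)

lemma clifford_on_common:
  obtains F where "finite F" "x \<in> clifford_on F" "y \<in> clifford_on F"
proof -
  obtain J K where "finite J" "x \<in> clifford_on J" "finite K" "y \<in> clifford_on K"
    using clifford_on_finite by meson
  then show thesis using that[of "J \<union> K"] by (simp add: clifford_on_mono)
qed

text \<open>Common indices of two blades drop out in pairs, so the degree of their product has the
  parity of the sum of the degrees.\<close>

lemma grade_mult: "grade (x * y) = grade x * grade y"
proof (rule coord_eqI)
  fix S
  obtain F where F: "finite F" and x: "x \<in> clifford_on F" and y: "y \<in> clifford_on F"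
    by (rule clifford_on_common)
  show "coord (grade (x * y)) S = coord (grade x * grade y) S"
  proof (cases "S \<subseteq> F")
    case True
    \<comment> \<open>The parity count is \<open>prod_pm_sym_diff\<close> for the constant factor
      \<open>-1\<close>. It requires finite sets; for \<open>S\<close> not inside \<open>F\<close>
      both coordinates vanish.\<close>
    have sgn: "(-1 :: real) ^ card S = (-1) ^ card A * (-1) ^ card (sym_diff A S)" if "A \<in> Pow F" for A
    proof -
      have fin: "finite A" "finite S" using True that F finite_subset by auto
      have "sym_diff A (sym_diff A S) = S" by auto
      then show ?thesis
        using prod_pm_sym_diff[of A "sym_diff A S" "\<lambda>_. -1"] fin by (simp add: prod_constant)
    qed
    show ?thesis
      unfolding grade.rep_eq coord_times[OF F x y] coord_times[OF F grade_in[OF x] grade_in[OF y]]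
        sum_distrib_left
      by (intro sum.cong refl) (simp add: sgn mult_ac)
  next
    case False
    then have "coord (grade (x * y)) S = 0" "coord (grade x * grade y) S = 0"
      using clifford_onD[of _ F S] by (meson x y grade_in clifford_on_mult)+
    then show ?thesis by simp
  qed
qed

text \<open>Each generator passed by \<open>gen 0\<close> costs a sign, and the grade involution
  counts exactly these signs.\<close>

lemma delta_mult:
  assumes "finite I" "0 \<notin> I" "x \<in> clifford_on I"
  shows "gen 0 * x = grade x * gen 0"
  using assms(1,3)
proof (induction rule: clifford_on_induct)
  case (gen i x)
  then have "gen 0 * gen i = - (gen i * gen 0)"
    using assms(2) by (intro gen_anticommute) auto
  then have "gen 0 * (gen i * x) = - (gen i * (gen 0 * x))"
    by (metis mult.assoc minus_mult_left)
  then show ?case using gen by (simp add: grade_mult grade_gen mult.assoc)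
qed (simp_all add: grade_one grade_add grade_scaleR algebra_simps)

lemma delta_split:
  assumes "finite I" "0 \<notin> I" "x \<in> clifford_on (insert 0 I)"
  shows "\<exists>a\<in>clifford_on I. \<exists>b\<in>clifford_on I. x = a + b * gen 0"
proof -
  have "finite (insert 0 I)" using assms(1) by simp
  then show ?thesis using assms(3)
  proof (induction rule: clifford_on_induct)
    case one
    then show ?case
      by (intro bexI[of _ 1] bexI[of _ 0]) (auto intro: clifford_on_intros)
  next
    case (gen i x)
    then obtain a b where ab: "a \<in> clifford_on I" "b \<in> clifford_on I" "x = a + b * gen 0"
      by blast
    show ?case
    proof (cases "i = 0")
      case True
      \<comment> \<open>Left multiplication by \<delta> kills \<open>b * gen 0\<close>, since
        \<delta> b \<delta> = \<sigma>(b) \<delta> \<delta> = 0, and turns \<open>a\<close> into the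
        new coefficient \<sigma>(a) of \<delta>.\<close>
      have "gen 0 * gen 0 = 0" using gen_square[of 0] by simp
      then have "gen 0 * x = grade a * gen 0"
        using ab delta_mult[OF assms(1,2)] by (simp add: distrib_left flip: mult.assoc)
          (simp add: mult.assoc)
      then show ?thesis using True ab
        by (intro bexI[of _ 0] bexI[of _ "grade a"]) (auto intro: clifford_on_intros grade_in)
    next
      case False
      then have "gen i \<in> clifford_on I" using gen by (intro gen_in) auto
      then show ?thesis using ab
        by (intro bexI[of _ "gen i * a"] bexI[of _ "gen i * b"])
          (auto intro: clifford_on_intros simp: algebra_simps)
    qed
  next
    case (add x y)
    then obtain a b c d where "a \<in> clifford_on I" "b \<in> clifford_on I" "x = a + b * gen 0"
      "c \<in> clifford_on I" "d \<in> clifford_on I" "y = c + d * gen 0" by blast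
    then show ?case
      by (intro bexI[of _ "a + c"] bexI[of _ "b + d"])
        (auto intro: clifford_on_intros simp: algebra_simps)
  next
    case (scaleR r x)
    then obtain a b where "a \<in> clifford_on I" "b \<in> clifford_on I" "x = a + b * gen 0" by blast
    then show ?case
      by (intro bexI[of _ "r *\<^sub>R a"] bexI[of _ "r *\<^sub>R b"])
        (auto intro: clifford_on_intros simp: algebra_simps)
  qed
qed

section \<open>The scalar part of a product and its positivity\<close>

lemma coord_times_empty:
  assumes "finite F" "x \<in> clifford_on F" "y \<in> clifford_on F"
  shows "coord (x * y) {} = (\<Sum>A\<in>Pow F. blade_coeff A A * coord x A * coord y A)"
  using coord_times[OF assms, of "{}"] by simp

text \<open>Only equal blades multiply to a scalar, and their real coefficients commute; so the
  scalar part is a trace on the noncommutative algebra.\<close>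

lemma coord_times_empty_commute: "coord (x * y) {} = coord (y * x) {}"
proof -
  obtain F where "finite F" "x \<in> clifford_on F" "y \<in> clifford_on F"
    by (rule clifford_on_common)
  then show ?thesis by (simp add: coord_times_empty mult_ac)
qed

text \<open>A generator e of square 1 or -1 satisfies e* e = 1, hence so does every blade over
  nonzero indices. The index 0 has to be excluded because its generator squares to 0.\<close>

lemma star_sign_blade_coeff:
  assumes "finite A" "0 \<notin> A"
  shows "star_sign A * blade_coeff A A = 1"
proof -
  have "clifford_star (blade A) * blade A = 1"
    using assms
  proof (induction A rule: finite_linorder_min_induct)
    case empty
    then show ?case by (simp add: blade_empty star_one)
  next
    case (insert i A)
    then have "clifford_star (gen i) * gen i = 1"
      by (auto simp: star_gen gen_square sgn_if)
    moreover have "blade (insert i A) = gen i * blade A"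
      using insert by (intro blade_insert_min) auto
    ultimately show ?case using insert
      by (simp add: star_mult mult.assoc) (metis mult.assoc mult_1)
  qed
  moreover have "clifford_star (blade A) = star_sign A *\<^sub>R blade A"
    by (rule coord_eqI) (simp add: clifford_star.rep_eq blade.rep_eq scaleR_clifford.rep_eq)
  ultimately have "(star_sign A * blade_coeff A A) *\<^sub>R (1 :: clifford) = 1"
    using assms by (simp add: blade_mult blade_empty)
  then show ?thesis by (metis scaleR_cancel_right scaleR_one zero_neq_one)
qed

text \<open>The star signs cancel the squares of the blades, which leaves a Euclidean norm. All
  later positivity rests on this.\<close>

lemma coord_star_times_self:
  assumes "finite F" "0 \<notin> F" "x \<in> clifford_on F"
  shows "coord (clifford_star x * x) {} = (\<Sum>A\<in>Pow F. (coord x A)\<^sup>2)"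
proof -
  have "blade_coeff A A * (star_sign A * coord x A) * coord x A = (coord x A)\<^sup>2" if "A \<in> Pow F" for A
  proof -
    have "star_sign A * blade_coeff A A = 1"
      using that assms finite_subset by (intro star_sign_blade_coeff) auto
    then show ?thesis by (simp add: power2_eq_square mult_ac)
  qed
  then show ?thesis
    using assms by (simp add: coord_times_empty[OF assms(1) star_in] clifford_star.rep_eq)
qed

section \<open>Orthogonal decomposition\<close>

text \<open>Gram-Schmidt projection for a form that is assumed definite only on the subspace
  \<open>S\<close>, not on the whole type.\<close>

lemma orthogonal_split_span:
  fixes \<beta> :: "'a::real_vector \<Rightarrow> 'a \<Rightarrow> real"
  assumes lin: "\<And>x. linear (\<beta> x)" and sym: "\<And>x y. \<beta> x y = \<beta> y x"
    and S: "subspace S" and pos: "\<And>x. x \<in> S \<Longrightarrow> \<beta> x x = 0 \<Longrightarrow> x = 0"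
    and "finite B" "B \<subseteq> S" "x \<in> S"
  shows "\<exists>s\<in>span B. \<forall>b\<in>span B. \<beta> b (x - s) = 0"
proof -
  note [simp] = linear_add[OF lin] linear_diff[OF lin] linear_cmul[OF lin] linear_0[OF lin]
  have "\<exists>s\<in>span B. \<forall>b\<in>B. \<beta> b (x - s) = 0" if "x \<in> S" for x
    using \<open>finite B\<close> \<open>B \<subseteq> S\<close> that
  proof (induction B arbitrary: x)
    case empty
    then show ?case by (auto simp: span_zero)
  next
    case (insert b B)
    obtain s where s: "s \<in> span B" "\<forall>c\<in>B. \<beta> c (b - s) = 0" using insert by (metis insert_subset)
    obtain u where u: "u \<in> span B" "\<forall>c\<in>B. \<beta> c (x - u) = 0" using insert by (metis insert_subset)
    \<comment> \<open>\<open>k\<close> is the part of the new vector \<open>b\<close> orthogonal to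
      \<open>span B\<close>, so a correction along \<open>k\<close> preserves the conditions already
      met for \<open>B\<close>.\<close>
    define k where "k = b - s"
    have perp: "\<beta> s y = 0" if "\<forall>c\<in>B. \<beta> c y = 0" for y
    proof -
      have "\<beta> y s = 0"
        using that sym by (intro linear_eq_0_on_span[OF lin _ s(1)]) metis
      then show ?thesis using sym by metis
    qed
    have "s \<in> S" using s(1) insert.prems S by (meson insert_subset span_minimal subsetD)
    then have "k \<in> S" unfolding k_def using insert.prems S by (auto intro: subspace_diff)
    \<comment> \<open>If \<open>\<beta> k k = 0\<close>, then \<open>k = 0\<close> by definiteness,
      and the default value 0 of the quotient is harmless.\<close>
    define c where "c = \<beta> k (x - u) / \<beta> k k"
    have kk: "\<beta> k (x - u - c *\<^sub>R k) = 0"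
      using pos[OF \<open>k \<in> S\<close>] by (cases "\<beta> k k = 0") (auto simp: c_def sym[of 0])
    have orth: "\<forall>d\<in>B. \<beta> d (x - u - c *\<^sub>R k) = 0" using u(2) s(2) by (simp add: k_def)
    moreover have "\<beta> b (x - u - c *\<^sub>R k) = 0"
    proof -
      let ?z = "x - u - c *\<^sub>R k"
      have "\<beta> b ?z = \<beta> ?z (k + s)" by (simp add: k_def sym[of b] del: linear_diff[OF lin])
      also have "\<dots> = \<beta> k ?z + \<beta> s ?z"
        by (simp only: linear_add[OF lin] sym[of ?z])
      finally show ?thesis using kk perp[OF orth] by simp
    qed
    moreover have "u + c *\<^sub>R k \<in> span (insert b B)"
      unfolding k_def using u(1) s(1)
      by (intro span_add span_scale span_diff) (auto intro: span_base span_mono[THEN subsetD])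
    ultimately show ?case by (intro bexI[of _ "u + c *\<^sub>R k"]) (auto simp: diff_diff_eq)
  qed
  then obtain s where s: "s \<in> span B" "\<forall>b\<in>B. \<beta> b (x - s) = 0" using \<open>x \<in> S\<close> by blast
  have "\<beta> b (x - s) = 0" if "b \<in> span B" for b
  proof -
    have "\<beta> (x - s) b = 0"
      using s(2) sym by (intro linear_eq_0_on_span[OF lin _ that]) metis
    then show ?thesis by (simp add: sym)
  qed
  then show ?thesis using s(1) by blast
qed

text \<open>The images of a finite spanning set span the image of \<open>L\<close>, so Gram-Schmidt
  projects \<open>x\<close> onto this image.\<close>

lemma orthogonal_split_image:
  fixes \<beta> :: "'a::real_vector \<Rightarrow> 'a \<Rightarrow> real" and L :: "'a \<Rightarrow> 'a"
  assumes "\<And>x. linear (\<beta> x)" and "\<And>x y. \<beta> x y = \<beta> y x"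
    and "finite B" and S: "S = span B" and "\<And>x. x \<in> S \<Longrightarrow> \<beta> x x = 0 \<Longrightarrow> x = 0"
    and L: "linear L" "\<And>x. x \<in> S \<Longrightarrow> L x \<in> S" and "x \<in> S"
  shows "\<exists>y\<in>S. \<forall>z\<in>S. \<beta> (L z) (x - L y) = 0"
proof -
  have im: "span (L ` B) = L ` S"
    unfolding S by (rule linear_span_image[OF L(1)])
  have "L ` B \<subseteq> S" using L(2) S by (auto intro: span_base)
  then have "\<exists>s\<in>span (L ` B). \<forall>b\<in>span (L ` B). \<beta> b (x - s) = 0"
    by (intro orthogonal_split_span[where S = S]) (use assms subspace_span in auto)
  then show ?thesis unfolding im by auto
qed

section \<open>Matrix algebra over the Clifford algebra\<close>

notation adjoint_matrix ("_\<^sup>\<dagger>" [1000] 999)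

definition grade_matrix :: "clifford^'n^'n \<Rightarrow> clifford^'n^'n" ("_\<^sup>\<sigma>" [1000] 999) where
  "M\<^sup>\<sigma> = (\<chi> i j. grade (M $ i $ j))"

text \<open>Keeping only scalar parts gives a real trace that is cyclic although the entries do not
  commute, and that is invariant under both involutions.\<close>

definition mtrace :: "clifford^'n^'n \<Rightarrow> real" where
  "mtrace M = (\<Sum>i\<in>UNIV. coord (M $ i $ i) {})"

lemma matrix_mul_diff_distrib:
  fixes A B C :: "'a::ring_1^'n^'n"
  shows "(A + B) ** C = A ** C + B ** C" "(A - B) ** C = A ** C - B ** C"
    "A ** (B - C) = A ** B - A ** C" "(- A) ** B = - (A ** B)" "A ** (- B) = - (A ** B)"
  by (simp_all add: matrix_matrix_mult_def vec_eq_iff algebra_simps sum.distrib sum_subtractf sum_negf)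

lemma matrix_mul_zero:
  fixes A :: "'a::semiring_1^'n^'n"
  shows "0 ** A = 0" "A ** 0 = 0"
  by (simp_all add: matrix_matrix_mult_def vec_eq_iff)

lemma matrix_mul_scaleR:
  fixes A B :: "'a::real_algebra_1^'n^'n"
  shows "(r *\<^sub>R A) ** B = r *\<^sub>R (A ** B)" "A ** (r *\<^sub>R B) = r *\<^sub>R (A ** B)"
  by (simp_all add: matrix_matrix_mult_def vec_eq_iff scaleR_sum_right)

lemmas matrix_algebra = matrix_add_ldistrib matrix_mul_diff_distrib matrix_mul_zero
  matrix_mul_scaleR matrix_mul_assoc

lemma star_zero: "clifford_star 0 = 0"
  and star_diff: "clifford_star (x - y) = clifford_star x - clifford_star y"
  and star_uminus: "clifford_star (- x) = - clifford_star x"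
  and grade_zero: "grade 0 = 0"
  by (transfer; simp add: fun_eq_iff algebra_simps)+

lemma star_sum: "clifford_star (sum f X) = (\<Sum>a\<in>X. clifford_star (f a))"
  by (induction X rule: infinite_finite_induct) (simp_all add: star_zero star_add)

lemma grade_sum: "grade (sum f X) = (\<Sum>a\<in>X. grade (f a))"
  by (induction X rule: infinite_finite_induct) (simp_all add: grade_zero grade_add)

lemma adjoint_matrix_simps [simp]:
  "(A + B)\<^sup>\<dagger> = A\<^sup>\<dagger> + B\<^sup>\<dagger>" "(A - B)\<^sup>\<dagger> = A\<^sup>\<dagger> - B\<^sup>\<dagger>" "(- A)\<^sup>\<dagger> = - A\<^sup>\<dagger>"
  "(r *\<^sub>R A)\<^sup>\<dagger> = r *\<^sub>R A\<^sup>\<dagger>" "(A ** B)\<^sup>\<dagger> = B\<^sup>\<dagger> ** A\<^sup>\<dagger>" "(A\<^sup>\<dagger>)\<^sup>\<dagger> = A"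
  "(mat x)\<^sup>\<dagger> = mat (clifford_star x)" "0\<^sup>\<dagger> = 0"
  by (auto simp: adjoint_matrix_def vec_eq_iff star_add star_diff star_uminus star_scaleR star_star
      matrix_matrix_mult_def star_sum star_mult mat_def star_zero)

lemma grade_matrix_simps [simp]:
  "(A + B)\<^sup>\<sigma> = A\<^sup>\<sigma> + B\<^sup>\<sigma>" "(A - B)\<^sup>\<sigma> = A\<^sup>\<sigma> - B\<^sup>\<sigma>" "(- A)\<^sup>\<sigma> = - A\<^sup>\<sigma>"
  "(r *\<^sub>R A)\<^sup>\<sigma> = r *\<^sub>R A\<^sup>\<sigma>" "(A ** B)\<^sup>\<sigma> = A\<^sup>\<sigma> ** B\<^sup>\<sigma>" "(A\<^sup>\<sigma>)\<^sup>\<sigma> = A"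
  "(mat x)\<^sup>\<sigma> = mat (grade x)" "0\<^sup>\<sigma> = 0"
  by (auto simp: grade_matrix_def vec_eq_iff grade_add grade_diff grade_uminus grade_scaleR grade_grade
      matrix_matrix_mult_def grade_sum grade_mult mat_def grade_zero)

lemma grade_matrix_adjoint [simp]: "(A\<^sup>\<dagger>)\<^sup>\<sigma> = (A\<^sup>\<sigma>)\<^sup>\<dagger>"
  by (simp add: grade_matrix_def adjoint_matrix_def grade_star)

lemma mtrace_simps:
  "mtrace (A + B) = mtrace A + mtrace B" "mtrace (A - B) = mtrace A - mtrace B"
  "mtrace (- A) = - mtrace A" "mtrace (r *\<^sub>R A) = r * mtrace A" "mtrace (0 :: clifford^'n^'n) = 0"
  for A B :: "clifford^'n^'n"
  by (simp_all add: mtrace_def plus_clifford.rep_eq minus_clifford.rep_eq uminus_clifford.rep_eq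
      scaleR_clifford.rep_eq zero_clifford.rep_eq sum.distrib sum_subtractf sum_negf sum_distrib_left)

lemma mtrace_adjoint: "mtrace (A\<^sup>\<dagger>) = mtrace A"
  by (simp add: mtrace_def adjoint_matrix_def clifford_star.rep_eq star_sign_def numeral_2_eq_2)

lemma mtrace_grade: "mtrace (A\<^sup>\<sigma>) = mtrace A"
  by (simp add: mtrace_def grade_matrix_def grade.rep_eq)

lemma mtrace_mult_commute: "mtrace (A ** B) = mtrace (B ** A)"
proof -
  have "mtrace (A ** B) = (\<Sum>i\<in>UNIV. \<Sum>k\<in>UNIV. coord (A $ i $ k * B $ k $ i) {})"
    by (simp add: mtrace_def matrix_matrix_mult_def coord_sum)
  also have "\<dots> = (\<Sum>k\<in>UNIV. \<Sum>i\<in>UNIV. coord (A $ i $ k * B $ k $ i) {})"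
    by (rule sum.swap)
  also have "\<dots> = mtrace (B ** A)"
    by (simp add: mtrace_def matrix_matrix_mult_def coord_sum coord_times_empty_commute)
  finally show ?thesis .
qed

lemma unitary_matrix_mult: "unitary_matrix U \<Longrightarrow> unitary_matrix V \<Longrightarrow> unitary_matrix (U ** V)"
  unfolding unitary_matrix_def adjoint_matrix_simps
  by (metis matrix_mul_assoc matrix_mul_rid)

lemma linear_mtrace_mult: "linear (\<lambda>B. mtrace (A\<^sup>\<dagger> ** B))"
  by (rule linearI) (simp_all add: matrix_algebra mtrace_simps)

lemma mtrace_form_sym: "mtrace (A\<^sup>\<dagger> ** B) = mtrace (B\<^sup>\<dagger> ** A)"
  using mtrace_adjoint[of "A\<^sup>\<dagger> ** B"] by simp

lemma subspace_matrix_over: "subspace {M. matrix_over (clifford_on I) M}"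
  by (auto simp: subspace_def matrix_over_def intro: clifford_on_intros)

lemma matrix_over_intros:
  "matrix_over (clifford_on I) A \<Longrightarrow> matrix_over (clifford_on I) B \<Longrightarrow> matrix_over (clifford_on I) (A + B)"
  "matrix_over (clifford_on I) A \<Longrightarrow> matrix_over (clifford_on I) B \<Longrightarrow> matrix_over (clifford_on I) (A - B)"
  "matrix_over (clifford_on I) A \<Longrightarrow> matrix_over (clifford_on I) (- A)"
  "matrix_over (clifford_on I) A \<Longrightarrow> matrix_over (clifford_on I) (r *\<^sub>R A)"
  "matrix_over (clifford_on I) A \<Longrightarrow> matrix_over (clifford_on I) B \<Longrightarrow> matrix_over (clifford_on I) (A ** B)"
  "matrix_over (clifford_on I) A \<Longrightarrow> matrix_over (clifford_on I) (A\<^sup>\<dagger>)"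
  "matrix_over (clifford_on I) A \<Longrightarrow> matrix_over (clifford_on I) (A\<^sup>\<sigma>)"
  "matrix_over (clifford_on I) 0"
  "x \<in> clifford_on I \<Longrightarrow> matrix_over (clifford_on I) (mat x)"
proof -
  have diff: "x - y \<in> clifford_on I" if "x \<in> clifford_on I" "y \<in> clifford_on I" for x y
    using clifford_on_add[OF that(1) clifford_on_uminus[OF that(2)]] by simp
  have sum: "(\<Sum>k\<in>X. f k) \<in> clifford_on I" if "\<And>k. f k \<in> clifford_on I" for f and X :: "'n set"
    using that by (induction X rule: infinite_finite_induct) (auto intro: clifford_on_intros)
  assume A: "matrix_over (clifford_on I) A"
  then show "matrix_over (clifford_on I) (- A)" "matrix_over (clifford_on I) (r *\<^sub>R A)"
    "matrix_over (clifford_on I) (A\<^sup>\<dagger>)" "matrix_over (clifford_on I) (A\<^sup>\<sigma>)"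
    by (auto simp: matrix_over_def adjoint_matrix_def grade_matrix_def star_in grade_in
      intro: clifford_on_intros)
  assume "matrix_over (clifford_on I) B"
  with A show "matrix_over (clifford_on I) (A + B)" "matrix_over (clifford_on I) (A - B)"
    "matrix_over (clifford_on I) (A ** B)"
    by (auto simp: matrix_over_def matrix_matrix_mult_def intro!: clifford_on_intros diff sum)
qed (auto simp: matrix_over_def mat_def intro: clifford_on_intros)

lemma diagonal_matrix_mult:
  assumes "diagonal_matrix D"
  shows "(A ** D) $ i $ j = A $ i $ j * D $ j $ j" "(D ** A) $ i $ j = D $ i $ i * A $ i $ j"
proof -
  have "(\<Sum>k\<in>UNIV. A $ i $ k * D $ k $ j) = (\<Sum>k\<in>UNIV. if k = j then A $ i $ j * D $ j $ j else 0)"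
    "(\<Sum>k\<in>UNIV. D $ i $ k * A $ k $ j) = (\<Sum>k\<in>UNIV. if k = i then D $ i $ i * A $ i $ j else 0)"
    using assms by (intro sum.cong refl; force simp: diagonal_matrix_def)+
  then show "(A ** D) $ i $ j = A $ i $ j * D $ j $ j" "(D ** A) $ i $ j = D $ i $ i * A $ i $ j"
    by (simp_all add: matrix_matrix_mult_def)
qed

text \<open>Real multiples of 1 are central and fixed by both involutions, so these weights pass
  through every twist below.\<close>

definition real_diag :: "('n \<Rightarrow> real) \<Rightarrow> clifford^'n^'n" where
  "real_diag k = (\<chi> i j. if i = j then k i *\<^sub>R 1 else 0)"

lemma real_diag_diagonal: "diagonal_matrix (real_diag k)"
  by (simp add: diagonal_matrix_def real_diag_def)

lemma real_diag_adjoint: "(real_diag k)\<^sup>\<dagger> = real_diag k"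
  by (auto simp: real_diag_def adjoint_matrix_def vec_eq_iff star_scaleR star_one star_zero)

lemma real_diag_grade: "(real_diag k)\<^sup>\<sigma> = real_diag k"
  by (auto simp: real_diag_def grade_matrix_def vec_eq_iff grade_scaleR grade_one grade_zero)

lemma real_diag_over: "matrix_over (clifford_on I) (real_diag k)"
  by (auto simp: real_diag_def matrix_over_def intro: clifford_on_intros)

lemma real_diag_entry: "real_diag k $ i $ i = k i *\<^sub>R 1"
  by (simp add: real_diag_def)

lemma real_diag_commute:
  assumes "diagonal_matrix D"
  shows "real_diag k ** D = D ** real_diag k"
proof -
  have "k i *\<^sub>R D $ i $ j = k j *\<^sub>R D $ i $ j" for i j
    using assms by (cases "i = j") (auto simp: diagonal_matrix_def)
  then show ?thesis
    by (simp add: vec_eq_iff diagonal_matrix_mult[OF real_diag_diagonal] real_diag_entry)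
qed

text \<open>Entrywise, the squares of \<open>k i\<close> and \<open>k j\<close> act equally on
  \<open>P $ i $ j\<close>. Positivity of the weights keeps their squares distinct.\<close>

lemma diagonal_if_commute:
  assumes k: "inj k" "\<And>i. k i > 0"
    and PL: "real_diag k ** real_diag k ** P = P ** real_diag k ** real_diag k"
  shows "diagonal_matrix P"
  unfolding diagonal_matrix_def
proof (intro allI impI)
  fix i j :: 'a assume "i \<noteq> j"
  have "real_diag k ** (real_diag k ** P) = P ** real_diag k ** real_diag k"
    using PL by (simp only: matrix_mul_assoc)
  from arg_cong[OF this, of "\<lambda>M. M $ i $ j"]
  have "(k i * k i) *\<^sub>R P $ i $ j = (k j * k j) *\<^sub>R P $ i $ j"
    by (simp add: diagonal_matrix_mult[OF real_diag_diagonal] real_diag_entry)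
  moreover have "k i * k i \<noteq> k j * k j"
    using \<open>i \<noteq> j\<close> k by (metis injD less_imp_le power2_eq_imp_eq power2_eq_square)
  ultimately show "P $ i $ j = 0" by simp
qed

section \<open>The nondegenerate subalgebra and its positive definite trace form\<close>

locale nondegenerate_indices =
  fixes I :: "int set"
  assumes finite_I: "finite I" and zero_notin: "0 \<notin> I"
begin

abbreviation over :: "clifford^'n^'n \<Rightarrow> bool" where
  "over \<equiv> matrix_over (clifford_on I)"

lemma mtrace_adjoint_self:
  assumes "over M"
  shows "mtrace (M\<^sup>\<dagger> ** M) = (\<Sum>j\<in>UNIV. \<Sum>i\<in>UNIV. \<Sum>A\<in>Pow I. (coord (M $ i $ j) A)\<^sup>2)"
  using assms
  by (simp add: mtrace_def matrix_matrix_mult_def adjoint_matrix_def coord_sum matrix_over_def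
      coord_star_times_self[OF finite_I zero_notin])

lemma mtrace_pos: "over M \<Longrightarrow> 0 \<le> mtrace (M\<^sup>\<dagger> ** M)"
  by (simp add: mtrace_adjoint_self sum_nonneg)

text \<open>Serves twice: it yields definiteness of the trace form, and it bounds the coordinates
  for the compactness argument.\<close>

lemma coord_sq_le_mtrace:
  assumes "over M"
  shows "(coord (M $ i $ j) A)\<^sup>2 \<le> mtrace (M\<^sup>\<dagger> ** M)"
proof (cases "A \<in> Pow I")
  case True
  have "(coord (M $ i $ j) A)\<^sup>2 \<le> (\<Sum>A\<in>Pow I. (coord (M $ i $ j) A)\<^sup>2)"
    using finite_I True by (intro member_le_sum) auto
  also have "\<dots> \<le> (\<Sum>i\<in>UNIV. \<Sum>A\<in>Pow I. (coord (M $ i $ j) A)\<^sup>2)"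
    by (intro member_le_sum[of i UNIV "\<lambda>i. \<Sum>A\<in>Pow I. (coord (M $ i $ j) A)\<^sup>2"])
      (auto intro: sum_nonneg)
  also have "\<dots> \<le> mtrace (M\<^sup>\<dagger> ** M)"
    unfolding mtrace_adjoint_self[OF assms]
    by (intro member_le_sum[of j UNIV "\<lambda>j. \<Sum>i\<in>UNIV. \<Sum>A\<in>Pow I. (coord (M $ i $ j) A)\<^sup>2"])
      (auto intro!: sum_nonneg)
  finally show ?thesis .
next
  case False
  then have "coord (M $ i $ j) A = 0"
    using assms clifford_onD[of "M $ i $ j" I A] by (auto simp: matrix_over_def)
  then show ?thesis using mtrace_pos[OF assms] by simp
qed

lemma mtrace_eq_0:
  assumes "over M" "mtrace (M\<^sup>\<dagger> ** M) = 0"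
  shows "M = 0"
proof -
  have "coord (M $ i $ j) A = 0" for i j A
    using coord_sq_le_mtrace[OF assms(1), of i j A] assms(2) by simp
  then show ?thesis by (auto simp: vec_eq_iff zero_clifford.rep_eq intro!: coord_eqI)
qed

text \<open>Finite dimensionality, by matrix units that carry a blade in their single nonzero
  entry.\<close>

lemma over_finite_span:
  obtains B :: "(clifford^'n^'n) set" where "finite B" "{M. over M} = span B"
proof -
  define e :: "'n \<Rightarrow> 'n \<Rightarrow> int set \<Rightarrow> clifford^'n^'n" where
    "e i j A = (\<chi> a b. if a = i \<and> b = j then blade A else 0)" for i j A
  define B where "B = (\<lambda>(i, j, A). e i j A) ` (UNIV \<times> UNIV \<times> Pow I)"
  have fin: "finite B" unfolding B_def using finite_I by (intro finite_imageI finite_cartesian_product) auto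
  have "B \<subseteq> {M. over M}"
    by (auto simp: B_def e_def matrix_over_def blade_in clifford_on_zero)
  then have "span B \<subseteq> {M. over M}" using subspace_matrix_over by (rule span_minimal)
  moreover have "M \<in> span B" if M: "over M" for M
  proof -
    have "M = (\<Sum>i\<in>UNIV. \<Sum>j\<in>UNIV. \<Sum>A\<in>Pow I. coord (M $ i $ j) A *\<^sub>R e i j A)"
    proof -
      have "(\<Sum>i\<in>UNIV. \<Sum>j\<in>UNIV. \<Sum>A\<in>Pow I. coord (M $ i $ j) A *\<^sub>R e i j A) $ a $ b = M $ a $ b" for a b
      proof -
        have "(\<Sum>A\<in>Pow I. coord (M $ i $ j) A *\<^sub>R e i j A $ a $ b) =
          (if a = i then if b = j then M $ a $ b else 0 else 0)" for i j
          using blade_expansion[OF finite_I, of "M $ a $ b"] M by (auto simp: e_def matrix_over_def)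
        moreover have "(\<Sum>j\<in>UNIV. if a = i then if b = j then M $ a $ b else 0 else 0) =
          (if a = i then M $ a $ b else 0)" for i
          by simp
        ultimately show ?thesis by simp
      qed
      then show ?thesis by (simp add: vec_eq_iff)
    qed
    moreover have "e i j A \<in> span B" if "A \<in> Pow I" for i j A
      using that unfolding B_def by (intro span_base image_eqI[of _ _ "(i, j, A)"]) auto
    ultimately show ?thesis by (metis (no_types, lifting) span_scale span_sum)
  qed
  ultimately show thesis using that[OF fin] by blast
qed

lemma over_orthogonal_split:
  fixes M :: "clifford^'n^'n" and L :: "clifford^'n^'n \<Rightarrow> clifford^'n^'n"
  assumes L: "linear L" "\<And>Z. over Z \<Longrightarrow> over (L Z)" and "over M"
  obtains Y where "over Y" "\<And>Z. over Z \<Longrightarrow> mtrace ((L Z)\<^sup>\<dagger> ** (M - L Y)) = 0"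
proof -
  obtain B :: "(clifford^'n^'n) set" where "finite B" "{M. over M} = span B"
    by (rule over_finite_span)
  then have "\<exists>y\<in>{M. over M}. \<forall>z\<in>{M. over M}. mtrace ((L z)\<^sup>\<dagger> ** (M - L y)) = 0"
    by (intro orthogonal_split_image[where B = B and \<beta> = "\<lambda>A B. mtrace (A\<^sup>\<dagger> ** B)"]
        linear_mtrace_mult mtrace_form_sym) (use assms mtrace_eq_0 in auto)
  then show thesis using that by auto
qed

section \<open>Compactness\<close>

text \<open>
  Matrices carry no topology here; they are parametrized by their coordinates, a point of the
  product space of all real functions on indices.
\<close>

definition param :: "('n \<times> 'n \<times> int set \<Rightarrow> real) \<Rightarrow> clifford^'n^'n" where
  "param g = (\<chi> i j. \<Sum>A\<in>Pow I. g (i, j, A) *\<^sub>R blade A)"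

text \<open>Requiring values over \<open>I\<close> makes every coordinate of a product one fixed
  finite sum over \<open>Pow I\<close>, so continuity of products can be checked
  coordinatewise.\<close>

definition cont :: "(('n \<times> 'n \<times> int set \<Rightarrow> real) \<Rightarrow> clifford^'n^'n) \<Rightarrow> bool" where
  "cont F \<longleftrightarrow> (\<forall>g. over (F g)) \<and> (\<forall>i j A. continuous_on UNIV (\<lambda>g. coord (F g $ i $ j) A))"

lemma coord_param: "coord (param g $ i $ j) A = (if A \<in> Pow I then g (i, j, A) else 0)"
proof -
  have "coord (param g $ i $ j) A = (\<Sum>B\<in>Pow I. if B = A then g (i, j, A) else 0)"
    using finite_subset[OF _ finite_I] unfolding param_def
    by (auto simp: coord_sum scaleR_clifford.rep_eq blade.rep_eq simp del: sum.delta sum.delta'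
        intro!: sum.cong)
  then show ?thesis using finite_I by simp
qed

lemma over_param: "over (param g)"
  unfolding matrix_over_def clifford_on_def by (auto simp: coord_param split: if_splits)

lemma param_coord:
  assumes "over M"
  shows "param (\<lambda>(i, j, A). coord (M $ i $ j) A) = M"
proof -
  have "coord (M $ i $ j) A = 0" if "A \<notin> Pow I" for i j A
    using assms clifford_onD[of "M $ i $ j" I A] that by (auto simp: matrix_over_def)
  then show ?thesis by (auto simp: vec_eq_iff coord_param intro!: coord_eqI)
qed

lemma cont_param: "cont (param :: _ \<Rightarrow> clifford^'n^'n)"
proof -
  have "continuous_on UNIV (\<lambda>g. coord (param g $ i $ j) A)" for i j :: 'n and A
    by (cases "A \<in> Pow I") (simp_all add: coord_param)
  then show ?thesis by (simp add: cont_def over_param)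
qed

lemma cont_const: "over M \<Longrightarrow> cont (\<lambda>_. M)"
  by (simp add: cont_def)

lemma cont_adjoint: "cont F \<Longrightarrow> cont (\<lambda>g. (F g)\<^sup>\<dagger>)"
  unfolding cont_def
  by (auto intro: matrix_over_intros)
    (auto simp: adjoint_matrix_def clifford_star.rep_eq intro: continuous_intros)

lemma cont_grade: "cont F \<Longrightarrow> cont (\<lambda>g. (F g)\<^sup>\<sigma>)"
  unfolding cont_def
  by (auto intro: matrix_over_intros)
    (auto simp: grade_matrix_def grade.rep_eq intro: continuous_intros)

lemma cont_mult:
  assumes "cont F" "cont G"
  shows "cont (\<lambda>g. F g ** G g)"
proof -
  have "coord ((F g ** G g) $ i $ j) S = (\<Sum>k\<in>UNIV. \<Sum>A\<in>Pow I.
      blade_coeff A (sym_diff A S) * coord (F g $ i $ k) A * coord (G g $ k $ j) (sym_diff A S))"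
    for g i j S
    using assms unfolding cont_def matrix_over_def
    by (simp add: matrix_matrix_mult_def coord_sum coord_times[OF finite_I])
  then show ?thesis
    using assms unfolding cont_def
    by (auto intro: matrix_over_intros intro!: continuous_intros)
qed

lemmas cont_intros = cont_param cont_const cont_adjoint cont_grade cont_mult

lemma continuous_mtrace: "cont F \<Longrightarrow> continuous_on UNIV (\<lambda>g. mtrace (F g))"
  unfolding cont_def mtrace_def by (auto intro!: continuous_intros)

lemma closed_cont_eq:
  assumes "cont F" "cont G"
  shows "closed {g. F g = G g}"
proof -
  have "{g. F g = G g} = {g. \<forall>i j A. coord (F g $ i $ j) A = coord (G g $ i $ j) A}"
    by (auto simp: vec_eq_iff intro: coord_eqI)
  also have "closed \<dots>"
    using assms unfolding cont_def by (intro closed_Collect_all closed_Collect_eq) auto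
  finally show ?thesis .
qed

text \<open>Tychonoff's theorem; the indices of \<open>param\<close> range over all sets of
  integers, so the box has infinitely many factors.\<close>

lemma compact_box: "compact (PiE UNIV (\<lambda>_. {- c..c}) :: ('a \<Rightarrow> real) set)"
proof -
  have "compactin (product_topology (\<lambda>_. euclidean) UNIV) (PiE UNIV (\<lambda>_. {- c..c}) :: ('a \<Rightarrow> real) set)"
    by (subst compactin_PiE) simp
  then show ?thesis by (simp add: euclidean_product_topology)
qed

lemma attains_max:
  fixes G :: "(clifford^'n^'n) set" and f :: "clifford^'n^'n \<Rightarrow> real"
  assumes closed: "closed {g. param g \<in> G}"
    and bounded: "\<And>M. M \<in> G \<Longrightarrow> over M" "\<And>M. M \<in> G \<Longrightarrow> mtrace (M\<^sup>\<dagger> ** M) \<le> c"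
    and "U0 \<in> G" and cont: "continuous_on UNIV (\<lambda>g. f (param g))"
  shows "\<exists>U\<in>G. \<forall>V\<in>G. f V \<le> f U"
proof -
  \<comment> \<open>The box makes the parameter set compact and still represents all of
    \<open>G\<close>: the coordinates of a member are bounded by \<open>sqrt c\<close>.\<close>
  define C where "C = {g. param g \<in> G} \<inter> PiE UNIV (\<lambda>_. {- sqrt c..sqrt c})"
  define co :: "clifford^'n^'n \<Rightarrow> 'n \<times> 'n \<times> int set \<Rightarrow> real"
    where "co M = (\<lambda>(i, j, A). coord (M $ i $ j) A)" for M
  have co: "co M \<in> C" "param (co M) = M" if "M \<in> G" for M
  proof -
    show eq: "param (co M) = M" unfolding co_def using bounded that by (intro param_coord) simp
    have "\<bar>coord (M $ i $ j) A\<bar> \<le> sqrt c" for i j A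
      using coord_sq_le_mtrace[of M i j A] bounded[OF that] by (intro real_le_rsqrt) simp
    then have "co M \<in> PiE UNIV (\<lambda>_. {- sqrt c..sqrt c})"
      by (auto simp: co_def abs_le_iff minus_le_iff)
    then show "co M \<in> C" using that eq by (simp add: C_def)
  qed
  have "compact C" unfolding C_def by (intro closed_Int_compact closed compact_box)
  moreover have "C \<noteq> {}" using co \<open>U0 \<in> G\<close> by auto
  ultimately obtain g where g: "g \<in> C" "\<forall>h\<in>C. f (param h) \<le> f (param g)"
    using continuous_attains_sup[of C] continuous_on_subset[OF cont] by (metis subset_UNIV)
  show ?thesis
  proof (intro bexI ballI)
    show "param g \<in> G" using g by (simp add: C_def)
    show "f V \<le> f (param g)" if "V \<in> G" for V using g(2) co[OF that] by metis
  qed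
qed

section \<open>Diagonalization by maximization\<close>

text \<open>The unitaries that fix \<open>Q\<close> under the twisted action
  \<open>U\<^sup>\<dagger> ** Q ** U\<^sup>\<sigma>\<close>. For \<open>Q = 0\<close> this is the
  full unitary group over \<open>I\<close>.\<close>

definition stab :: "clifford^'n^'n \<Rightarrow> (clifford^'n^'n) set" where
  "stab Q = {U. over U \<and> unitary_matrix U \<and> Q ** U\<^sup>\<sigma> = U ** Q}"

lemma stab_mult:
  assumes "U \<in> stab Q" "V \<in> stab Q"
  shows "U ** V \<in> stab Q"
proof -
  have Q: "Q ** U\<^sup>\<sigma> = U ** Q" "Q ** V\<^sup>\<sigma> = V ** Q" using assms by (simp_all add: stab_def)
  have "Q ** (U ** V)\<^sup>\<sigma> = U ** (Q ** V\<^sup>\<sigma>)" by (simp add: matrix_mul_assoc Q(1))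
  also have "\<dots> = U ** V ** Q" unfolding Q(2) by (rule matrix_mul_assoc)
  finally show ?thesis using assms by (simp add: stab_def matrix_over_intros unitary_matrix_mult)
qed

lemma closed_stab:
  assumes "over Q"
  shows "closed {g. param g \<in> stab Q}"
proof -
  have one: "over (mat 1)" by (simp add: matrix_over_intros clifford_on_one)
  have "{g. param g \<in> stab Q} = {g. param g ** (param g)\<^sup>\<dagger> = mat 1} \<inter>
      {g. (param g)\<^sup>\<dagger> ** param g = mat 1} \<inter> {g. Q ** (param g)\<^sup>\<sigma> = param g ** Q}"
    by (auto simp: stab_def over_param unitary_matrix_def)
  then show ?thesis
    using assms one by (auto intro!: closed_Int closed_cont_eq cont_intros)
qed

lemma mtrace_one: "mtrace (mat 1 :: clifford^'n^'n) = CARD('n)"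
  by (simp add: mtrace_def mat_def one_clifford.rep_eq)

text \<open>\<open>1 + 2 X Y = (1 + X) (1 - X)\<^sup>-\<^sup>1\<close> is the Cayley transform of the skew matrix \<open>X\<close>.\<close>

lemma cayley_transform:
  fixes X Q :: "clifford^'n^'n"
  assumes X: "over X" "X\<^sup>\<dagger> = - X" and Q: "over Q" "Q ** X\<^sup>\<sigma> = X ** Q"
  obtains Y where "over Y" "mtrace (Y\<^sup>\<dagger> ** Y) \<le> CARD('n)" "Y = mat 1 + X ** Y"
    "mat 1 + 2 *\<^sub>R (X ** Y) \<in> stab Q"
proof -
  have one: "over (mat 1)" by (simp add: matrix_over_intros clifford_on_one)
  \<comment> \<open>Project the identity onto the image of left multiplication by
    \<open>mat 1 - W\<close>. The residual \<open>k\<close> is orthogonal to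
    \<open>(mat 1 - W) ** k\<close>, and the skew \<open>W\<close> contributes nothing to this
    pairing, so \<open>k\<close> has norm 0.\<close>
  have right_inverse: "\<exists>Y. over Y \<and> (mat 1 - W) ** Y = mat 1"
    if W: "over W" "W\<^sup>\<dagger> = - W" for W :: "clifford^'n^'n"
  proof -
    have "linear (\<lambda>Z :: clifford^'n^'n. (mat 1 - W) ** Z)"
      by (rule linearI) (simp_all add: matrix_add_ldistrib matrix_mul_scaleR)
    then obtain Y where Y: "over Y"
      "\<And>Z. over Z \<Longrightarrow> mtrace (((mat 1 - W) ** Z)\<^sup>\<dagger> ** (mat 1 - (mat 1 - W) ** Y)) = 0"
      by (rule over_orthogonal_split[of _ "mat 1"])
        (use W one in \<open>auto intro: matrix_over_intros clifford_on_one\<close>)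
    define k where "k = mat 1 - (mat 1 - W) ** Y"
    have k: "over k" unfolding k_def using W Y by (intro matrix_over_intros clifford_on_one)
    have "mtrace (((mat 1 - W) ** k)\<^sup>\<dagger> ** k) = 0" using Y(2)[OF k] by (simp add: k_def)
    then have "mtrace (k\<^sup>\<dagger> ** k) + mtrace (k\<^sup>\<dagger> ** W ** k) = 0"
      using W(2) by (simp add: matrix_algebra mtrace_simps star_one)
    moreover have "mtrace (k\<^sup>\<dagger> ** W ** k) = 0"
      using mtrace_adjoint[of "k\<^sup>\<dagger> ** W ** k"] W(2) by (simp add: matrix_algebra mtrace_simps)
    ultimately have "k = 0" using mtrace_eq_0[OF k] by simp
    then show ?thesis using Y(1) by (auto simp: k_def)
  qed
  obtain Y where Y: "over Y" "(mat 1 - X) ** Y = mat 1" using right_inverse X by blast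
  \<comment> \<open>The adjoint of a right inverse of \<open>mat 1 + X\<close> is a left inverse of
    \<open>mat 1 - X\<close>; this makes \<open>Y\<close> two-sided.\<close>
  obtain Z where Z: "over Z" "(mat 1 - (- X)) ** Z = mat 1"
    using right_inverse[of "- X"] X by (auto intro: matrix_over_intros)
  have Z': "Z\<^sup>\<dagger> ** (mat 1 - X) = mat 1"
    using arg_cong[OF Z(2), of adjoint_matrix] X(2) by (simp add: star_one)
  then have "Z\<^sup>\<dagger> = Y" using Y(2) by (metis matrix_mul_assoc matrix_mul_lid matrix_mul_rid)
  then have Yl: "Y ** (mat 1 - X) = mat 1" using Z' by simp
  have Yd: "Y\<^sup>\<dagger> ** (mat 1 + X) = mat 1" "(mat 1 + X) ** Y\<^sup>\<dagger> = mat 1"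
    using arg_cong[OF Y(2), of adjoint_matrix] arg_cong[OF Yl, of adjoint_matrix] X(2)
    by (simp_all add: star_one)
  have XY: "Y = mat 1 + X ** Y" "Y = mat 1 + Y ** X"
    using Y(2) Yl by (simp_all add: matrix_algebra algebra_simps)
  define V where "V = mat 1 + 2 *\<^sub>R (X ** Y)"
  have "X ** Y = Y ** X" using XY by (metis add_left_cancel)
  moreover have "V = (mat 1 + X ** Y) + X ** Y" by (simp add: V_def scaleR_2)
  then have "V = Y + X ** Y" unfolding XY(1)[symmetric] .
  ultimately have V: "V = (mat 1 + X) ** Y" "V = Y ** (mat 1 + X)"
    by (simp_all add: matrix_algebra)
  have Vd: "V\<^sup>\<dagger> = Y\<^sup>\<dagger> ** (mat 1 - X)"
    unfolding V(1) using X(2) by (simp add: star_one)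
  have "V\<^sup>\<dagger> ** V = Y\<^sup>\<dagger> ** ((mat 1 - X) ** Y) ** (mat 1 + X)"
    by (subst Vd, subst V(2)) (simp only: matrix_mul_assoc)
  then have 1: "V\<^sup>\<dagger> ** V = mat 1" using Y(2) Yd by simp
  have "V ** V\<^sup>\<dagger> = Y ** ((mat 1 + X) ** Y\<^sup>\<dagger>) ** (mat 1 - X)"
    by (subst Vd, subst V(2)) (simp only: matrix_mul_assoc)
  then have 2: "V ** V\<^sup>\<dagger> = mat 1" using Yd Yl by simp
  \<comment> \<open>Since \<open>Q\<close> intertwines \<open>X\<^sup>\<sigma>\<close> with
    \<open>X\<close>, it also intertwines the inverses \<open>Y\<^sup>\<sigma>\<close> and
    \<open>Y\<close>.\<close>
  have "Y ** Q = Y ** Q ** ((mat 1 - X) ** Y)\<^sup>\<sigma>" using Y(2) by (simp add: grade_one)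
  also have "\<dots> = Y ** (Q - Q ** X\<^sup>\<sigma>) ** Y\<^sup>\<sigma>" by (simp add: grade_one matrix_algebra)
  also have "\<dots> = Y ** (mat 1 - X) ** Q ** Y\<^sup>\<sigma>" by (simp add: Q(2) matrix_algebra)
  finally have YQ: "Y ** Q = Q ** Y\<^sup>\<sigma>" by (simp add: Yl)
  have "Q ** (X ** Y)\<^sup>\<sigma> = X ** (Q ** Y\<^sup>\<sigma>)" by (simp add: matrix_mul_assoc Q(2))
  then have "Q ** V\<^sup>\<sigma> = V ** Q"
    by (simp add: V_def matrix_algebra grade_one flip: YQ)
  moreover have "over V" unfolding V_def using X Y by (intro matrix_over_intros clifford_on_one)
  ultimately have "V \<in> stab Q" using 1 2 by (simp add: stab_def unitary_matrix_def)
  \<comment> \<open>For skew \<open>X\<close> the cross terms cancel, and the two remaining positive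
    terms add up to the identity. So the bound on \<open>Y\<close> is independent of the size of
    \<open>X\<close>.\<close>
  have "mat 1 = (Y\<^sup>\<dagger> ** (mat 1 + X)) ** ((mat 1 - X) ** Y)" using Y(2) Yd by simp
  also have "\<dots> = Y\<^sup>\<dagger> ** Y + (X ** Y)\<^sup>\<dagger> ** (X ** Y)"
    using X(2) by (simp add: matrix_algebra)
  finally have "CARD('n) = mtrace (Y\<^sup>\<dagger> ** Y) + mtrace ((X ** Y)\<^sup>\<dagger> ** (X ** Y))"
    by (metis mtrace_one mtrace_simps(1))
  moreover have "0 \<le> mtrace ((X ** Y)\<^sup>\<dagger> ** (X ** Y))"
    using X Y by (intro mtrace_pos matrix_over_intros)
  ultimately show thesis using that[OF Y(1) _ XY(1)] \<open>V \<in> stab Q\<close> unfolding V_def by simp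
qed

lemma exists_positive_weights: "\<exists>k :: 'n::finite \<Rightarrow> real. inj k \<and> (\<forall>i. k i > 0)"
proof -
  obtain f :: "'n \<Rightarrow> nat" where "inj f"
    using finite_imp_inj_to_nat_seg[of "UNIV :: 'n set"] by auto
  then show ?thesis
    by (intro exI[of _ "\<lambda>i. real (f i) + 1"]) (auto simp: inj_def)
qed

text \<open>A first derivative test without derivatives: at
  \<open>t = a / (\<bar>c\<bar> + 1)\<close> a nonzero linear term would outweigh the quadratic
  one.\<close>

lemma linear_coefficient_eq_0:
  fixes a c :: real
  assumes "\<And>t. 4 * t * a \<le> c * t\<^sup>2"
  shows "a = 0"
proof (rule ccontr)
  assume "a \<noteq> 0"
  let ?d = "\<bar>c\<bar> + 1"
  have "4 * (a / ?d) * a \<le> c * (a / ?d)\<^sup>2" by (rule assms)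
  also have "\<dots> \<le> ?d * (a / ?d)\<^sup>2" by (intro mult_right_mono) auto
  also have "\<dots> = (a / ?d) * a" by (simp add: power2_eq_square)
  finally have "a * a / ?d \<le> 0" by simp
  moreover have "a * a / ?d > 0" using \<open>a \<noteq> 0\<close> by (intro divide_pos_pos) (auto simp: zero_less_mult_iff)
  ultimately show False by simp
qed

text \<open>
  With weights \<open>\<Lambda>\<close>, the derivative of \<open>U \<mapsto> tr (\<Lambda> U\<^sup>\<dagger> P \<phi>(U))\<close> in the skew direction
  \<open>X = \<Lambda> R\<^sup>\<dagger> - R \<Lambda>\<close>, where \<open>R = U\<^sup>\<dagger> P \<phi>(U)\<close>, is a multiple of \<open>tr (X\<^sup>\<dagger> X)\<close>. So \<open>X = 0\<close> at a maximum,
  and applying \<open>\<phi>\<close> once more gives \<open>\<Lambda>\<^sup>2 R = R \<Lambda>\<^sup>2\<close>.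
\<close>

lemma diagonal_at_maximum:
  fixes P Q :: "clifford^'n^'n" and \<phi> :: "clifford^'n^'n \<Rightarrow> clifford^'n^'n"
  assumes phi: "\<phi> = (\<lambda>M. M) \<or> \<phi> = grade_matrix"
    and P: "over P" "(\<phi> P)\<^sup>\<dagger> = P" and Q: "over Q"
    and direction: "\<And>k U R. U \<in> stab Q \<Longrightarrow> R = U\<^sup>\<dagger> ** P ** \<phi> U \<Longrightarrow>
      Q ** (real_diag k ** R\<^sup>\<dagger> - R ** real_diag k)\<^sup>\<sigma> = (real_diag k ** R\<^sup>\<dagger> - R ** real_diag k) ** Q"
  obtains U where "U \<in> stab Q" "diagonal_matrix (U\<^sup>\<dagger> ** P ** \<phi> U)"
proof -
  \<comment> \<open>Either choice of \<phi> is an involutive real-linear automorphism that commutes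
    with the adjoint and fixes the weights, so both maximizations share one argument.\<close>
  have phi_simps: "\<phi> (A + B) = \<phi> A + \<phi> B" "\<phi> (A - B) = \<phi> A - \<phi> B" "\<phi> (r *\<^sub>R A) = r *\<^sub>R \<phi> A"
    "\<phi> (A ** B) = \<phi> A ** \<phi> B" "\<phi> (\<phi> A) = A" "\<phi> (A\<^sup>\<dagger>) = (\<phi> A)\<^sup>\<dagger>" "\<phi> (mat 1) = mat 1"
    "\<phi> (real_diag w) = real_diag w" for A B r w
    using phi by (auto simp: grade_one real_diag_grade)
  have phi_mtrace: "mtrace (\<phi> A) = mtrace A" for A
    using phi by (auto simp: mtrace_grade)
  have phi_cont: "cont (\<lambda>g. \<phi> (F g))" if "cont F" for F
    using phi that by (auto intro: cont_grade)
  have phi_over: "over (\<phi> A)" if "over A" for A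
    using phi that by (auto intro: matrix_over_intros)
  obtain k :: "'n \<Rightarrow> real" where k: "inj k" "\<And>i. k i > 0"
    using exists_positive_weights by blast
  define \<Lambda> :: "clifford^'n^'n" where "\<Lambda> = real_diag k"
  have Lam: "over \<Lambda>" "\<Lambda>\<^sup>\<dagger> = \<Lambda>" "\<phi> \<Lambda> = \<Lambda>"
    by (simp_all add: \<Lambda>_def real_diag_over real_diag_adjoint phi_simps)
  define f where "f U = mtrace (\<Lambda> ** U\<^sup>\<dagger> ** P ** \<phi> U)" for U
  have one: "over (mat 1)" by (simp add: matrix_over_intros clifford_on_one)
  have "\<exists>U\<in>stab Q. \<forall>V\<in>stab Q. f V \<le> f U"
  proof (rule attains_max)
    show "closed {g. param g \<in> stab Q}" by (rule closed_stab[OF Q])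
    show "over M" "mtrace (M\<^sup>\<dagger> ** M) \<le> CARD('n)" if "M \<in> stab Q" for M
      using that by (simp_all add: stab_def unitary_matrix_def mtrace_one)
    show "mat 1 \<in> stab Q"
      using one by (simp add: stab_def unitary_matrix_def star_one grade_one)
    show "continuous_on UNIV (\<lambda>g. f (param g))"
      unfolding f_def using Lam P by (intro continuous_mtrace cont_intros phi_cont)
  qed
  then obtain U where U: "U \<in> stab Q" and max: "\<And>V. V \<in> stab Q \<Longrightarrow> f V \<le> f U"
    by blast
  define R where "R = U\<^sup>\<dagger> ** P ** \<phi> U"
  define X where "X = \<Lambda> ** R\<^sup>\<dagger> - R ** \<Lambda>"
  have U_over: "over U" using U by (simp add: stab_def)
  have R: "over R" "R\<^sup>\<dagger> = \<phi> R"
    unfolding R_def using U_over P(1) arg_cong[OF P(2), of \<phi>]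
    by (simp_all add: phi_simps matrix_algebra phi_over matrix_over_intros)
  have X: "over X" "X\<^sup>\<dagger> = - X" "Q ** X\<^sup>\<sigma> = X ** Q"
    unfolding X_def using R(1) Lam direction[OF U R_def, of k, folded \<Lambda>_def]
    by (simp_all add: matrix_over_intros)
  \<comment> \<open>Taking adjoints, applying \<phi> and cycling identifies the two first-order
    terms of the expansion; hence the coefficient \<open>4 * t\<close> below.\<close>
  have tr_rot: "mtrace (\<Lambda> ** Z\<^sup>\<dagger> ** R) = mtrace (\<Lambda> ** R ** \<phi> Z)" for Z
  proof -
    have "mtrace (\<Lambda> ** Z\<^sup>\<dagger> ** R) = mtrace (\<phi> R ** Z ** \<Lambda>)"
      using mtrace_adjoint[of "\<Lambda> ** Z\<^sup>\<dagger> ** R"] Lam R by (simp add: matrix_mul_assoc)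
    also have "\<dots> = mtrace (R ** \<phi> Z ** \<Lambda>)"
      using phi_mtrace[of "\<phi> R ** Z ** \<Lambda>"] Lam by (simp add: phi_simps)
    also have "\<dots> = mtrace (\<Lambda> ** R ** \<phi> Z)"
      by (metis mtrace_mult_commute matrix_mul_assoc)
    finally show ?thesis .
  qed
  define a where "a = mtrace (\<Lambda> ** R ** \<phi> X)"
  \<comment> \<open>\<open>- r Y\<close> is the coefficient of \<open>t\<^sup>2\<close> in the
    expansion of \<open>f\<close> along the Cayley curve. It depends on \<open>t\<close> through
    \<open>Y\<close>; maximizing \<open>r\<close> over the compact ball that contains every such
    \<open>Y\<close> gives one constant for all \<open>t\<close>.\<close>
  define r where "r Y = - (4 * mtrace (\<Lambda> ** R ** \<phi> (X ** (X ** Y))) +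
    4 * mtrace (\<Lambda> ** (X ** Y)\<^sup>\<dagger> ** R ** \<phi> (X ** Y)))" for Y
  define ball where "ball = {Y :: clifford^'n^'n. over Y \<and> mtrace (Y\<^sup>\<dagger> ** Y) \<le> CARD('n)}"
  have "\<exists>Y0\<in>ball. \<forall>Y\<in>ball. r Y \<le> r Y0"
  proof (rule attains_max)
    show "over M" "mtrace (M\<^sup>\<dagger> ** M) \<le> CARD('n)" if "M \<in> ball" for M
      using that by (simp_all add: ball_def)
    show "closed {g. param g \<in> ball}"
      unfolding ball_def
      by (simp add: over_param)
        (intro closed_Collect_le continuous_mtrace cont_intros continuous_on_const)
    show "mat 1 \<in> ball"
      using one by (simp add: ball_def star_one mtrace_one)
    show "continuous_on UNIV (\<lambda>g. r (param g))"
      unfolding r_def using Lam R X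
      by (intro continuous_intros continuous_mtrace cont_intros phi_cont)
  qed
  then obtain Y0 where Y0: "\<And>Y. over Y \<Longrightarrow> mtrace (Y\<^sup>\<dagger> ** Y) \<le> CARD('n) \<Longrightarrow> r Y \<le> r Y0"
    by (auto simp: ball_def)
  have "4 * t * a \<le> r Y0 * t\<^sup>2" for t
  proof -
    obtain Y where Y: "over Y" "mtrace (Y\<^sup>\<dagger> ** Y) \<le> CARD('n)" "Y = mat 1 + (t *\<^sub>R X) ** Y"
      "mat 1 + 2 *\<^sub>R ((t *\<^sub>R X) ** Y) \<in> stab Q"
      by (rule cayley_transform[of "t *\<^sub>R X" Q])
        (use X Q in \<open>simp_all add: matrix_over_intros matrix_mul_scaleR\<close>)
    define Z where "Z = X ** Y"
    define V where "V = mat 1 + (2 * t) *\<^sub>R Z"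
    \<comment> \<open>Substituting the fixed-point equation for \<open>Y\<close> once separates the
      first-order direction \<open>X\<close> from a remainder of order \<open>t\<close>.\<close>
    have Z: "Z = X + t *\<^sub>R (X ** Z)"
      unfolding Z_def by (subst Y(3)) (simp add: matrix_algebra)
    have "V \<in> stab Q" using Y(4) by (simp add: V_def Z_def matrix_mul_scaleR)
    then have "f (U ** V) \<le> f U" by (intro max stab_mult U)
    also have "f U = mtrace (\<Lambda> ** R)" by (simp add: f_def R_def matrix_mul_assoc)
    also have "f (U ** V) = mtrace (\<Lambda> ** V\<^sup>\<dagger> ** R ** \<phi> V)"
      by (simp add: f_def R_def phi_simps matrix_mul_assoc)
    also have "\<dots> = mtrace (\<Lambda> ** R) + 4 * t * mtrace (\<Lambda> ** R ** \<phi> Z) +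
        4 * t\<^sup>2 * mtrace (\<Lambda> ** Z\<^sup>\<dagger> ** R ** \<phi> Z)"
      unfolding V_def
      by (simp add: phi_simps matrix_algebra mtrace_simps star_one tr_rot power2_eq_square
          distrib_left)
    also have "mtrace (\<Lambda> ** R ** \<phi> Z) = a + t * mtrace (\<Lambda> ** R ** \<phi> (X ** Z))"
      unfolding a_def by (subst Z) (simp only: phi_simps matrix_algebra mtrace_simps)
    finally have "4 * t * a \<le> r Y * t\<^sup>2"
      by (simp add: r_def flip: Z_def) (simp add: algebra_simps power2_eq_square)
    also have "\<dots> \<le> r Y0 * t\<^sup>2" by (intro mult_right_mono Y0 Y) simp
    finally show ?thesis .
  qed
  then have "a = 0" by (rule linear_coefficient_eq_0)
  have "a = mtrace (\<Lambda> ** R\<^sup>\<dagger> ** X)"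
    using phi_mtrace[of "\<Lambda> ** R ** \<phi> X"] Lam R by (simp add: a_def phi_simps)
  moreover have "mtrace (R ** \<Lambda> ** X) = - mtrace (\<Lambda> ** R\<^sup>\<dagger> ** X)"
  proof -
    have "mtrace (R ** \<Lambda> ** X) = - mtrace (X ** (\<Lambda> ** R\<^sup>\<dagger>))"
      using mtrace_adjoint[of "R ** \<Lambda> ** X"] Lam X(2)
      by (simp add: matrix_algebra mtrace_simps)
    then show ?thesis using mtrace_mult_commute[of X] by simp
  qed
  \<comment> \<open>Both traces on the right equal \<open>a\<close> up to opposite signs, so the
    squared norm of \<open>X\<close> is \<open>-2 * a\<close>.\<close>
  moreover have "mtrace (X\<^sup>\<dagger> ** X) = - (mtrace (\<Lambda> ** R\<^sup>\<dagger> ** X) - mtrace (R ** \<Lambda> ** X))"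
    unfolding X(2) by (subst (1) X_def) (simp add: matrix_algebra mtrace_simps)
  ultimately have "mtrace (X\<^sup>\<dagger> ** X) = 0" using \<open>a = 0\<close> by simp
  then have "X = 0" using mtrace_eq_0 X(1) by blast
  then have comm: "\<Lambda> ** \<phi> R = R ** \<Lambda>" using R by (simp add: X_def)
  from arg_cong[OF this, of \<phi>] have "\<Lambda> ** R = \<phi> R ** \<Lambda>" using Lam by (simp add: phi_simps)
  then have "\<Lambda> ** \<Lambda> ** R = R ** \<Lambda> ** \<Lambda>" using comm by (metis matrix_mul_assoc)
  then have "diagonal_matrix R" unfolding \<Lambda>_def by (rule diagonal_if_commute[OF k])
  then show thesis using that[OF U] by (simp add: R_def)
qed

section \<open>Simultaneous diagonalization of the two components\<close>

lemma simultaneous_diagonalization: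
  fixes H E :: "clifford^'n^'n"
  assumes H: "over H" "H\<^sup>\<dagger> = H" and E: "over E" "(E\<^sup>\<sigma>)\<^sup>\<dagger> = E"
    and comm: "E ** H\<^sup>\<sigma> = H ** E"
  obtains U where "over U" "unitary_matrix U"
    "diagonal_matrix (U\<^sup>\<dagger> ** H ** U)" "diagonal_matrix (U\<^sup>\<dagger> ** E ** U\<^sup>\<sigma>)"
proof -
  \<comment> \<open>With \<open>Q = 0\<close> no stabilizer condition restricts the unitary, and the
    condition on the direction is trivial.\<close>
  obtain U where U: "U \<in> stab 0" "diagonal_matrix (U\<^sup>\<dagger> ** E ** U\<^sup>\<sigma>)"
    by (rule diagonal_at_maximum[of grade_matrix E 0])
      (use E in \<open>simp_all add: matrix_over_intros matrix_mul_zero\<close>)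
  define E' where "E' = U\<^sup>\<dagger> ** E ** U\<^sup>\<sigma>"
  define H' where "H' = U\<^sup>\<dagger> ** H ** U"
  have U': "over U" "U ** U\<^sup>\<dagger> = mat 1" "unitary_matrix U"
    using U by (simp_all add: stab_def unitary_matrix_def)
  have "U\<^sup>\<sigma> ** (U\<^sup>\<sigma>)\<^sup>\<dagger> = mat 1"
    using arg_cong[OF U'(2), of grade_matrix] by (simp add: grade_one)
  then have cancel: "A ** U ** U\<^sup>\<dagger> = A" "A ** U\<^sup>\<sigma> ** (U\<^sup>\<sigma>)\<^sup>\<dagger> = A" for A
    using U'(2) by (simp_all flip: matrix_mul_assoc)
  have over': "over E'" "over H'" unfolding E'_def H'_def using E H U' by (simp_all add: matrix_over_intros)
  have H'_adj: "H'\<^sup>\<dagger> = H'" using H by (simp add: H'_def matrix_mul_assoc)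
  have diag: "diagonal_matrix E'" using U by (simp add: E'_def)
  have comm': "E' ** H'\<^sup>\<sigma> = H' ** E'"
  proof -
    have "E' ** H'\<^sup>\<sigma> = U\<^sup>\<dagger> ** (E ** H\<^sup>\<sigma>) ** U\<^sup>\<sigma>"
      by (simp add: E'_def H'_def matrix_mul_assoc cancel)
    also have "\<dots> = H' ** E'"
      unfolding comm by (simp add: E'_def H'_def matrix_mul_assoc cancel)
    finally show ?thesis .
  qed
  obtain V where V: "V \<in> stab E'" "diagonal_matrix (V\<^sup>\<dagger> ** H' ** V)"
  \<comment> \<open>The remaining task is tangency: the direction built from \<open>R\<close> must
    intertwine with \<open>E'\<close>. Both \<open>R\<close> and the weights do so
    separately.\<close>
  proof (rule diagonal_at_maximum[of "\<lambda>M. M" H' E'])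
    fix k V R assume V: "V \<in> stab E'" and R: "R = V\<^sup>\<dagger> ** H' ** V"
    have VE: "E' ** V\<^sup>\<sigma> = V ** E'" "V\<^sup>\<dagger> ** V = mat 1" "V ** V\<^sup>\<dagger> = mat 1"
      using V by (simp_all add: stab_def unitary_matrix_def)
    have VE': "E' ** (V\<^sup>\<dagger>)\<^sup>\<sigma> = V\<^sup>\<dagger> ** E'"
    proof -
      have "V\<^sup>\<dagger> ** (V ** E') ** (V\<^sup>\<sigma>)\<^sup>\<dagger> = V\<^sup>\<dagger> ** E' ** (V ** V\<^sup>\<dagger>)\<^sup>\<sigma>"
        unfolding VE(1)[symmetric] by (simp add: matrix_mul_assoc)
      then show ?thesis by (simp add: matrix_mul_assoc VE grade_one)
    qed
    have Radj: "R\<^sup>\<dagger> = R" using H'_adj by (simp add: R matrix_mul_assoc)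
    have RE: "E' ** R\<^sup>\<sigma> = R ** E'"
    proof -
      have "E' ** R\<^sup>\<sigma> = V\<^sup>\<dagger> ** (E' ** H'\<^sup>\<sigma>) ** V\<^sup>\<sigma>"
        using VE' by (simp add: R matrix_mul_assoc)
      also have "\<dots> = V\<^sup>\<dagger> ** H' ** (E' ** V\<^sup>\<sigma>)" unfolding comm' by (simp add: matrix_mul_assoc)
      also have "\<dots> = R ** E'" unfolding VE(1) by (simp add: R matrix_mul_assoc)
      finally show ?thesis .
    qed
    \<comment> \<open>Here the first maximization enters: central weights commute with
      \<open>E'\<close> because \<open>E'\<close> is already diagonal.\<close>
    have LE: "real_diag k ** E' = E' ** real_diag k" by (rule real_diag_commute[OF diag])
    have "E' ** (real_diag k ** R)\<^sup>\<sigma> = real_diag k ** R ** E'"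
      by (simp add: real_diag_grade matrix_mul_assoc flip: LE) (simp add: RE flip: matrix_mul_assoc)
    moreover have "E' ** (R ** real_diag k)\<^sup>\<sigma> = R ** real_diag k ** E'"
      by (simp add: real_diag_grade matrix_mul_assoc RE) (simp add: LE flip: matrix_mul_assoc)
    ultimately show "E' ** (real_diag k ** R\<^sup>\<dagger> - R ** real_diag k)\<^sup>\<sigma> =
        (real_diag k ** R\<^sup>\<dagger> - R ** real_diag k) ** E'"
      unfolding Radj by (simp add: matrix_algebra)
  qed (use over' H'_adj in auto)
  have V': "over V" "unitary_matrix V" "E' ** V\<^sup>\<sigma> = V ** E'" "V\<^sup>\<dagger> ** V = mat 1"
    using V by (simp_all add: stab_def unitary_matrix_def)
  \<comment> \<open>The second unitary stabilizes \<open>E'\<close>, so the diagonal form reached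
    first is not disturbed.\<close>
  have "V\<^sup>\<dagger> ** E' ** V\<^sup>\<sigma> = E'"
    using V' by (metis matrix_mul_assoc matrix_mul_lid)
  show thesis
  proof (rule that)
    show "over (U ** V)" using U' V' by (intro matrix_over_intros)
    show "unitary_matrix (U ** V)" using U' V' by (intro unitary_matrix_mult)
    show "diagonal_matrix ((U ** V)\<^sup>\<dagger> ** H ** (U ** V))"
      using V(2) by (simp add: H'_def matrix_mul_assoc)
    have "(U ** V)\<^sup>\<dagger> ** E ** (U ** V)\<^sup>\<sigma> = V\<^sup>\<dagger> ** E' ** V\<^sup>\<sigma>"
      by (simp add: E'_def matrix_mul_assoc)
    then show "diagonal_matrix ((U ** V)\<^sup>\<dagger> ** E ** (U ** V)\<^sup>\<sigma>)"
      using diag \<open>V\<^sup>\<dagger> ** E' ** V\<^sup>\<sigma> = E'\<close> by simp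
  qed
qed

section \<open>Reduction of the \<delta>-component by a unitary conjugation\<close>

lemma commuting_part:
  fixes H E :: "clifford^'n^'n"
  assumes H: "over H" "H\<^sup>\<dagger> = H" and E: "over E" "(E\<^sup>\<sigma>)\<^sup>\<dagger> = E"
  obtains X K where "over X" "(X\<^sup>\<sigma>)\<^sup>\<dagger> = - X" "K = E + X ** H\<^sup>\<sigma> - H ** X"
    "over K" "(K\<^sup>\<sigma>)\<^sup>\<dagger> = K" "K ** H\<^sup>\<sigma> = H ** K"
proof -
  define L where "L Z = Z ** H\<^sup>\<sigma> - H ** Z" for Z
  have L_add: "L (A + B) = L A + L B" and L_diff: "L (A - B) = L A - L B"
    and L_scaleR: "L (r *\<^sub>R A) = r *\<^sub>R L A" for A B r
    by (simp_all add: L_def matrix_algebra algebra_simps)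
  have L_over: "over (L Z)" if "over Z" for Z
    unfolding L_def using that H by (intro matrix_over_intros)
  have H_grade: "(H\<^sup>\<sigma>)\<^sup>\<dagger> = H\<^sup>\<sigma>" using H(2) by (simp flip: grade_matrix_adjoint)
  have L_twist: "L ((Z\<^sup>\<sigma>)\<^sup>\<dagger>) = - ((L Z)\<^sup>\<sigma>)\<^sup>\<dagger>" for Z
    using H(2) H_grade by (simp add: L_def)
  have "linear L" by (rule linearI) (simp_all add: L_add L_scaleR)
  then obtain Y where Y: "over Y" "\<And>Z. over Z \<Longrightarrow> mtrace ((L Z)\<^sup>\<dagger> ** (E - L Y)) = 0"
    using over_orthogonal_split L_over E(1) by metis
  define W where "W = E - L Y"
  have W: "over W" unfolding W_def using E Y L_over by (intro matrix_over_intros)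
  have L_adj: "mtrace ((L A)\<^sup>\<dagger> ** B) = mtrace (A\<^sup>\<dagger> ** L B)" for A B
  proof -
    have "mtrace (H\<^sup>\<sigma> ** (A\<^sup>\<dagger> ** B)) = mtrace (A\<^sup>\<dagger> ** B ** H\<^sup>\<sigma>)" by (rule mtrace_mult_commute)
    then show ?thesis
      using H(2) H_grade by (simp add: L_def matrix_algebra mtrace_simps)
  qed
  \<comment> \<open>The residual \<open>W\<close> is orthogonal to the image of \<open>L\<close>, in
    particular to \<open>L (L W)\<close>; moving one \<open>L\<close> across gives the norm of
    \<open>L W\<close>.\<close>
  have "mtrace ((L W)\<^sup>\<dagger> ** L W) = 0"
    using Y(2)[OF L_over[OF W]] L_adj[of "L W" W] by (simp add: W_def)
  then have LW: "L W = 0" by (intro mtrace_eq_0 L_over W)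
  \<comment> \<open>\<open>L\<close> anticommutes with the twisted adjoint
    \<open>(Z\<^sup>\<sigma>)\<^sup>\<dagger>\<close>. So the odd part of \<open>- Y\<close> under
    it goes with the even part of \<open>W\<close>: \<open>X\<close> gets the sign that makes 1 + X
    \<delta> unitary, and \<open>K\<close> the symmetry of \<open>E\<close>.\<close>
  define X where "X = (1 / 2) *\<^sub>R ((Y\<^sup>\<sigma>)\<^sup>\<dagger> - Y)"
  define K where "K = (1 / 2) *\<^sub>R (W + (W\<^sup>\<sigma>)\<^sup>\<dagger>)"
  have "E + L X = (1 / 2) *\<^sub>R (E - L Y) + (1 / 2) *\<^sub>R (E - ((L Y)\<^sup>\<sigma>)\<^sup>\<dagger>)"
  proof -
    have "E = (1 / 2) *\<^sub>R E + (1 / 2) *\<^sub>R E" by (simp flip: scaleR_add_left)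
    then show ?thesis
      by (simp add: X_def L_scaleR L_diff L_twist algebra_simps)
  qed
  also have "E - ((L Y)\<^sup>\<sigma>)\<^sup>\<dagger> = (W\<^sup>\<sigma>)\<^sup>\<dagger>" using E(2) by (simp add: W_def)
  finally have K: "K = E + L X" by (simp add: K_def W_def scaleR_add_right)
  have "L K = 0" unfolding K_def by (simp add: L_scaleR L_add L_twist LW)
  show thesis
  proof (rule that[of X K])
    show "over X" unfolding X_def using Y by (intro matrix_over_intros)
    show "(X\<^sup>\<sigma>)\<^sup>\<dagger> = - X" by (simp add: X_def flip: scaleR_minus_right)
    show "K = E + X ** H\<^sup>\<sigma> - H ** X" by (simp add: K L_def)
    show "over K" unfolding K_def using W by (intro matrix_over_intros)
    show "(K\<^sup>\<sigma>)\<^sup>\<dagger> = K" by (simp add: K_def add.commute)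
    show "K ** H\<^sup>\<sigma> = H ** K" using \<open>L K = 0\<close> by (simp add: L_def)
  qed
qed

lemma mat_delta:
  fixes M :: "clifford^'n^'n"
  shows "(mat (gen 0))\<^sup>\<dagger> = (mat (gen 0) :: clifford^'n^'n)"
    and "mat (gen 0) ** mat (gen 0) = (0 :: clifford^'n^'n)"
    and "over M \<Longrightarrow> mat (gen 0) ** M = M\<^sup>\<sigma> ** mat (gen 0)"
proof -
  have D: "diagonal_matrix (mat (gen 0) :: clifford^'n^'n)" by (simp add: diagonal_matrix_def mat_def)
  show "(mat (gen 0))\<^sup>\<dagger> = (mat (gen 0) :: clifford^'n^'n)" by (simp add: star_gen)
  have "gen 0 * gen 0 = 0" using gen_square[of 0] by simp
  then show "mat (gen 0) ** mat (gen 0) = (0 :: clifford^'n^'n)"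
    by (simp add: vec_eq_iff diagonal_matrix_mult[OF D]) (simp add: mat_def)
  show "mat (gen 0) ** M = M\<^sup>\<sigma> ** mat (gen 0)" if "over M"
    using that
    by (simp add: vec_eq_iff diagonal_matrix_mult[OF D])
      (simp add: mat_def grade_matrix_def matrix_over_def delta_mult[OF finite_I zero_notin])
qed

section \<open>Assembly over the full algebra\<close>

lemma self_adjoint_diagonalization:
  fixes H :: "clifford^'n^'n"
  assumes H: "matrix_over (clifford_on (insert 0 I)) H" "self_adjoint H"
  obtains U D where "matrix_over (clifford_on (insert 0 I)) U" "unitary_matrix U"
    "matrix_over (clifford_on (insert 0 I)) D" "diagonal_matrix D" "U ** D ** U\<^sup>\<dagger> = H"
proof -
  define \<delta> :: "clifford^'n^'n" where "\<delta> = mat (gen 0)"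
  have delta: "\<delta>\<^sup>\<dagger> = \<delta>" "\<delta> ** \<delta> = 0" "\<And>M. over M \<Longrightarrow> \<delta> ** M = M\<^sup>\<sigma> ** \<delta>"
    unfolding \<delta>_def by (fact mat_delta)+
  have over_mono: "matrix_over (clifford_on (insert 0 I)) M" if "over M" for M :: "clifford^'n^'n"
    using that clifford_on_mono[of _ I "insert 0 I"] by (auto simp: matrix_over_def)
  have delta_over: "matrix_over (clifford_on (insert 0 I)) \<delta>"
    unfolding \<delta>_def by (intro matrix_over_intros gen_in) simp
  obtain A B where AB: "over A" "over B" "H = A + B ** \<delta>"
  proof -
    have "\<forall>i j. \<exists>a b. a \<in> clifford_on I \<and> b \<in> clifford_on I \<and> H $ i $ j = a + b * gen 0"
      using delta_split[OF finite_I zero_notin] H(1) by (auto simp: matrix_over_def Bex_def)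
    then obtain a b where ab: "\<And>i j. a i j \<in> clifford_on I" "\<And>i j. b i j \<in> clifford_on I"
      "\<And>i j. H $ i $ j = a i j + b i j * gen 0" by metis
    have D: "diagonal_matrix \<delta>" by (simp add: \<delta>_def diagonal_matrix_def mat_def)
    show thesis
    proof (rule that)
      show "over (\<chi> i j. a i j)" "over (\<chi> i j. b i j)" using ab by (simp_all add: matrix_over_def)
      show "H = (\<chi> i j. a i j) + (\<chi> i j. b i j) ** \<delta>"
        by (simp add: vec_eq_iff diagonal_matrix_mult[OF D] ab) (simp add: \<delta>_def mat_def)
    qed
  qed
  \<comment> \<open>Averaging \<open>H\<close> with its adjoint gives components with the required
    symmetries, without appeal to uniqueness of the splitting.\<close>
  define H0 where "H0 = (1 / 2) *\<^sub>R (A + A\<^sup>\<dagger>)"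
  define E where "E = (1 / 2) *\<^sub>R (B + (B\<^sup>\<sigma>)\<^sup>\<dagger>)"
  have H0: "over H0" "H0\<^sup>\<dagger> = H0" and E: "over E" "(E\<^sup>\<sigma>)\<^sup>\<dagger> = E"
    unfolding H0_def E_def using AB by (auto intro: matrix_over_intros simp: add.commute)
  have "H\<^sup>\<dagger> = A\<^sup>\<dagger> + (B\<^sup>\<sigma>)\<^sup>\<dagger> ** \<delta>"
    using AB delta by (simp add: matrix_over_intros)
  then have "H = (1 / 2) *\<^sub>R (A + B ** \<delta>) + (1 / 2) *\<^sub>R (A\<^sup>\<dagger> + (B\<^sup>\<sigma>)\<^sup>\<dagger> ** \<delta>)"
    using H(2) AB(3) by (simp add: self_adjoint_def flip: scaleR_add_left)
  then have H_split: "H = H0 + E ** \<delta>"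
    by (simp add: H0_def E_def matrix_algebra algebra_simps)
  obtain X K where X: "over X" "(X\<^sup>\<sigma>)\<^sup>\<dagger> = - X" and K: "K = E + X ** H0\<^sup>\<sigma> - H0 ** X"
    "over K" "(K\<^sup>\<sigma>)\<^sup>\<dagger> = K" "K ** H0\<^sup>\<sigma> = H0 ** K"
    by (rule commuting_part[OF H0 E])
  have nil: "M ** \<delta> ** \<delta> = 0" for M
    using delta(2) by (simp add: matrix_mul_zero flip: matrix_mul_assoc)
  have swap: "A ** \<delta> ** M = A ** M\<^sup>\<sigma> ** \<delta>" if "over M" for A M
    using delta(3)[OF that] by (metis matrix_mul_assoc)
  \<comment> \<open>The adjoint of \<open>X ** \<delta>\<close> is
    \<open>(X\<^sup>\<sigma>)\<^sup>\<dagger> ** \<delta>\<close>, that is, its negative; as its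
    square is 0, the adjoint of \<open>V\<close> is its inverse.\<close>
  define V where "V = mat 1 + X ** \<delta>"
  have V_adj: "V\<^sup>\<dagger> = mat 1 - X ** \<delta>"
    using X delta by (simp add: V_def star_one matrix_over_intros matrix_algebra)
  have V: "unitary_matrix V"
    unfolding unitary_matrix_def V_adj
    by (simp add: V_def matrix_algebra swap[OF X(1)] nil)
  have V_H: "V ** H ** V\<^sup>\<dagger> = H0 + K ** \<delta>"
    unfolding V_adj H_split K(1)
    by (simp add: V_def matrix_algebra swap[OF X(1)] swap[OF H0(1)] swap[OF E(1)] nil algebra_simps)
  obtain U where U: "over U" "unitary_matrix U"
    and diag: "diagonal_matrix (U\<^sup>\<dagger> ** H0 ** U)" "diagonal_matrix (U\<^sup>\<dagger> ** K ** U\<^sup>\<sigma>)"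
    by (rule simultaneous_diagonalization[OF H0 K(2-4)])
  define W where "W = V\<^sup>\<dagger> ** U"
  define D where "D = W\<^sup>\<dagger> ** H ** W"
  have V_dag: "unitary_matrix (V\<^sup>\<dagger>)" using V by (simp add: unitary_matrix_def)
  have W: "unitary_matrix W" unfolding W_def by (intro unitary_matrix_mult V_dag U)
  have V_over: "matrix_over (clifford_on (insert 0 I)) V"
    unfolding V_def using X over_mono delta_over
    by (intro matrix_over_intros clifford_on_one) auto
  show thesis
  proof (rule that[of W D])
    show W_over: "matrix_over (clifford_on (insert 0 I)) W"
      unfolding W_def using V_over over_mono[OF U(1)] by (intro matrix_over_intros)
    show "unitary_matrix W" by (rule W)
    show "matrix_over (clifford_on (insert 0 I)) D"
      unfolding D_def using W_over H(1) by (intro matrix_over_intros)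
    \<comment> \<open>Moving \<delta> to the right past \<open>U\<close> twists \<open>U\<close> by
      the grade involution, which is why \<open>K\<close> was diagonalized with
      \<open>U\<^sup>\<sigma>\<close> on its right.\<close>
    have "D = U\<^sup>\<dagger> ** (V ** H ** V\<^sup>\<dagger>) ** U" by (simp add: D_def W_def matrix_mul_assoc)
    also have "\<dots> = U\<^sup>\<dagger> ** H0 ** U + U\<^sup>\<dagger> ** K ** U\<^sup>\<sigma> ** \<delta>"
      unfolding V_H by (simp add: matrix_algebra swap[OF U(1)])
    finally show "diagonal_matrix D"
      using diag diagonal_matrix_mult(1)[of \<delta>] unfolding diagonal_matrix_def
      by (simp add: \<delta>_def mat_def)
    show "W ** D ** W\<^sup>\<dagger> = H"
      using W unfolding D_def unitary_matrix_def
      by (metis matrix_mul_assoc matrix_mul_lid matrix_mul_rid)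
  qed
qed

end

theorem proposition10p2:
  fixes p q :: nat and H :: "clifford^'n^'n"
  assumes "matrix_over (Cl p q) H" and "self_adjoint H"
  shows "\<exists>U D :: clifford^'n^'n.
    matrix_over (Cl p q) U \<and> unitary_matrix U \<and>
    matrix_over (Cl p q) D \<and> diagonal_matrix D \<and>
    U ** D ** adjoint_matrix U = H"
proof -
  interpret nondegenerate_indices "{- int q..int p} - {0}"
    by unfold_locales auto
  \<comment> \<open>0 lies in the interval for all \<open>p\<close> and \<open>q\<close>, so
    reinserting it restores the full index set.\<close>
  have "Cl p q = clifford_on (insert 0 ({- int q..int p} - {0}))"
    unfolding Cl_def by (rule arg_cong[of _ _ clifford_on]) auto
  with assms show ?thesis
    by (metis self_adjoint_diagonalization)
qed

end
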